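(* Let $\Omega$ be a smoothly bounded, pseudoconvex domain in $\mathbb{C}^n$, and let $\delta$ be the signed distance function to $b\Omega$ (negative in $\Omega$). Then there exists a neighborhood $U$ of $b\Omega$ such that $-\log(-\delta(z))$ is plurisubharmonic for $z\in U\cap\Omega$.
   Context: A smoothly bounded domain $\Omega\subset\mathbb{C}^n$ is a bounded domain with smooth ($C^\infty$) boundary $b\Omega$. A local defining function for $\Omega$ in a neighborhood $U$ of $p\in b\Omega$ is a real-valued $r\in C^\infty(U)$ with $U\cap\Omega=\{z\in U: r(z)<0\}$ and $\nabla r(z)\neq 0$ for $z\in U$. For a $C^2$ function $f$, the complex Hessian at $p$ is $\mathcal{L}_{f(p)}(A,B)=\sum_{k,\ell=1}^n \frac{\partial^2 f}{\partial z_k\partial\bar z_\ell}(p)A_k\overline{B}_\ell$ for $A,B\in\mathbb{C}^n$. The complex tangent space to $b\Omega$ at $p\in b\Omega$ is $\mathbb{C}T_p(b\Omega)=\{V\in\mathbb{C}^n:\sum_{k=1}^n \frac{\partial r}{\partial z_k}(p)V_k=0\}$ (independent of the choice of local defining function $r$). $\Omega$ is pseudoconvex if near each boundary point, for a local defining function $r$, one has $\mathcal{L}_{r(p)}(V,V)\geq 0$ for all $p\in b\Omega$ near that point and all $V\in\mathbb{C}T_p(b\Omega)$ (this is independent of the choice of $r$). The signed distance function is $\delta(z)=-d(z)$ for $z\in\Omega$ and $\delta(z)=d(z)$ for $z\in\mathbb{C}^n\setminus\Omega$, where $d(z)=\inf_{q\in b\Omega}\|z-q\|$ is the Euclidean distance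 to $b\Omega$. It is smooth in some neighborhood of $b\Omega$. A $C^2$ function $f$ is plurisubharmonic on an open set if $\mathcal{L}_{f(z)}(W,W)\geq 0$ for all $z$ in that set and all $W\in\mathbb{C}^n$. *)

theory Defs
  imports "HOL-Analysis.Analysis"
begin

text \<open>
  \<open>Ck_on k U f\<close> is meant for open \<open>U\<close>. Derivatives are real: for \<open>f\<close> on \<open>complex ^ 'n\<close>
  they are taken with respect to the underlying real coordinates. In finite dimension, continuity
  of all directional derivatives is continuity of the total derivative.
\<close>

primrec Ck_on :: "nat \<Rightarrow> 'a::euclidean_space set \<Rightarrow> ('a \<Rightarrow> 'b::real_normed_vector) \<Rightarrow> bool" where
  "Ck_on 0 U f \<longleftrightarrow> continuous_on U f"
| "Ck_on (Suc k) U f \<longleftrightarrow>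
     (\<forall>x\<in>U. f differentiable at x) \<and> (\<forall>v. Ck_on k U (\<lambda>x. frechet_derivative f (at x) v))"

definition smooth_on :: "'a::euclidean_space set \<Rightarrow> ('a \<Rightarrow> 'b::real_normed_vector) \<Rightarrow> bool" where
  "smooth_on U f \<longleftrightarrow> (\<forall>k. Ck_on k U f)"

definition gradient :: "('a::euclidean_space \<Rightarrow> real) \<Rightarrow> 'a \<Rightarrow> 'a" where
  "gradient f x = (\<Sum>b\<in>Basis. frechet_derivative f (at x) b *\<^sub>R b)"

text \<open>
  The Wirtinger derivatives \<open>(\<partial>/\<partial>x\<^sub>k \<mp> \<i> \<partial>/\<partial>y\<^sub>k) / 2\<close>, where \<open>z\<^sub>k = x\<^sub>k + \<i> y\<^sub>k\<close>.
\<close>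

definition deriv_z :: "'n::finite \<Rightarrow> (complex ^ 'n \<Rightarrow> complex) \<Rightarrow> complex ^ 'n \<Rightarrow> complex" where
  "deriv_z k f p =
     (frechet_derivative f (at p) (axis k 1) - \<i> * frechet_derivative f (at p) (axis k \<i>)) / 2"

definition deriv_zbar :: "'n::finite \<Rightarrow> (complex ^ 'n \<Rightarrow> complex) \<Rightarrow> complex ^ 'n \<Rightarrow> complex" where
  "deriv_zbar k f p =
     (frechet_derivative f (at p) (axis k 1) + \<i> * frechet_derivative f (at p) (axis k \<i>)) / 2"

definition complex_hessian ::
  "(complex ^ 'n::finite \<Rightarrow> real) \<Rightarrow> complex ^ 'n \<Rightarrow> complex ^ 'n \<Rightarrow> complex ^ 'n \<Rightarrow> complex" where
  "complex_hessian f p A B =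
     (\<Sum>k\<in>UNIV. \<Sum>l\<in>UNIV.
        deriv_z k (deriv_zbar l (\<lambda>z. complex_of_real (f z))) p * (A $ k) * cnj (B $ l))"

definition local_defining_function ::
  "(complex ^ 'n::finite) set \<Rightarrow> complex ^ 'n \<Rightarrow> (complex ^ 'n) set \<Rightarrow> (complex ^ 'n \<Rightarrow> real) \<Rightarrow> bool" where
  "local_defining_function \<Omega> p U r \<longleftrightarrow>
     open U \<and> p \<in> U \<and> smooth_on U r \<and> U \<inter> \<Omega> = {z \<in> U. r z < 0} \<and> (\<forall>z\<in>U. gradient r z \<noteq> 0)"

definition smoothly_bounded_domain :: "(complex ^ 'n::finite) set \<Rightarrow> bool" where
  "smoothly_bounded_domain \<Omega> \<longleftrightarrow>
     open \<Omega> \<and> connected \<Omega> \<and> \<Omega> \<noteq> {} \<and> bounded \<Omega> \<and>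
     (\<forall>p\<in>frontier \<Omega>. \<exists>U r. local_defining_function \<Omega> p U r)"

definition complex_tangent_space ::
  "(complex ^ 'n::finite \<Rightarrow> real) \<Rightarrow> complex ^ 'n \<Rightarrow> (complex ^ 'n) set" where
  "complex_tangent_space r p =
     {V. (\<Sum>k\<in>UNIV. deriv_z k (\<lambda>z. complex_of_real (r z)) p * (V $ k)) = 0}"

text \<open>
  For \<open>f\<close> of class \<open>C\<^sup>2\<close> the complex Hessian is a Hermitian form, so its diagonal values are real
  and the inequalities below may be stated for their real parts.
\<close>

definition pseudoconvex :: "(complex ^ 'n::finite) set \<Rightarrow> bool" where
  "pseudoconvex \<Omega> \<longleftrightarrow>
     (\<forall>p\<in>frontier \<Omega>. \<exists>U r. local_defining_function \<Omega> p U r \<and>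
        (\<forall>q\<in>U \<inter> frontier \<Omega>. \<forall>V\<in>complex_tangent_space r q. 0 \<le> Re (complex_hessian r q V V)))"

definition plurisubharmonic_on :: "(complex ^ 'n::finite) set \<Rightarrow> (complex ^ 'n \<Rightarrow> real) \<Rightarrow> bool" where
  "plurisubharmonic_on S f \<longleftrightarrow>
     open S \<and> Ck_on 2 S f \<and> (\<forall>z\<in>S. \<forall>W. 0 \<le> Re (complex_hessian f z W W))"

definition signed_distance :: "(complex ^ 'n::finite) set \<Rightarrow> complex ^ 'n \<Rightarrow> real" where
  "signed_distance \<Omega> z =
     (if z \<in> \<Omega> then - infdist z (frontier \<Omega>) else infdist z (frontier \<Omega>))"

end

theory Submission
  imports Defs
begin

text \<open>
  Near the boundary the nearest point map \<open>y\<close> is \<open>C\<^sup>1\<close> by the inverse function theorem, and the squared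
  distance \<open>d\<^sup>2\<close> has gradient \<open>2 (z - y z)\<close>; hence \<open>- ln d\<close> is \<open>C\<^sup>2\<close>. For positivity of the complex
  Hessian we follow Hoermander. If it were negative at \<open>z\<close> in direction \<open>w\<close>, there would be \<open>A\<close>, \<open>B\<close> and
  \<open>c > 0\<close> with \<open>d (z + \<tau> w) \<ge> d z \<bar>exp (A \<tau> + B \<tau>\<^sup>2)\<bar> exp (c \<bar>\<tau>\<bar>\<^sup>2 / 2)\<close> for small \<open>\<tau>\<close>. With a nearest
  boundary point \<open>q\<close>, the holomorphic disc \<open>\<gamma>(\<tau>) = z + \<tau> w + exp (A \<tau> + B \<tau>\<^sup>2) (q - z)\<close> then touches the
  boundary from inside at \<open>q\<close> and has distance at least a multiple of \<open>\<bar>\<tau>\<bar>\<^sup>2\<close> to it. A defining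
  function composed with \<open>\<gamma>\<close> thus has a strict maximum at \<open>0\<close>, so \<open>\<gamma>'(0)\<close> is complex tangential and the
  Levi form is negative on it.
\<close>

subsection \<open>Functions of class \<open>C\<^sup>k\<close> and the complex Hessian\<close>

lemma frechet_derivative_eqI:
  "(f has_derivative f') (at x) \<Longrightarrow> frechet_derivative f (at x) = f'"
  by (metis frechet_derivative_at)

lemma Ck_on_cong:
  assumes "open S" "\<And>x. x \<in> S \<Longrightarrow> f x = g x" "Ck_on k S f"
  shows "Ck_on k S g"
  using assms(2,3)
proof (induction k arbitrary: f g)
  case 0
  then show ?case using continuous_on_cong[OF refl, of S f g] by simp
next
  case (Suc k)
  have D: "(g has_derivative frechet_derivative f (at x)) (at x)" if "x \<in> S" for x
  proof (rule has_derivative_transform_within_open[OF _ assms(1) that])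
    show "(f has_derivative frechet_derivative f (at x)) (at x)"
      using Suc.prems(2) that by (simp add: frechet_derivative_works)
  qed (use Suc.prems(1) in auto)
  have "Ck_on k S (\<lambda>x. frechet_derivative g (at x) v)" for v
  proof (rule Suc.IH)
    show "frechet_derivative f (at x) v = frechet_derivative g (at x) v" if "x \<in> S" for x
      using frechet_derivative_eqI[OF D[OF that]] by simp
    show "Ck_on k S (\<lambda>x. frechet_derivative f (at x) v)"
      using Suc.prems(2) by simp
  qed
  then show ?case using D by (auto simp: differentiable_def)
qed

text \<open>Continuity and differentiability are tested point by point; this glues regularity known
  near each point into regularity on the whole set.\<close>

lemma Ck_on_local:
  assumes "\<And>x. x \<in> S \<Longrightarrow> \<exists>T. open T \<and> x \<in> T \<and> Ck_on k T f"
  shows "Ck_on k S f"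
  using assms
proof (induction k arbitrary: f)
  case 0
  then show ?case
    by (metis Ck_on.simps(1) continuous_at_imp_continuous_on continuous_on_eq_continuous_at)
next
  case (Suc k)
  show ?case unfolding Ck_on.simps
  proof (intro conjI ballI allI)
    show "f differentiable at x" if "x \<in> S" for x using Suc.prems[OF that] by auto
    show "Ck_on k S (\<lambda>x. frechet_derivative f (at x) v)" for v
      by (rule Suc.IH) (use Suc.prems in fastforce)
  qed
qed

text \<open>Differentiating along \<open>v\<close> and then along \<open>u\<close> gives
  \<open>H x u \<bullet> v\<close>, so an explicit gradient field and its derivative settle
  membership in the class.\<close>

lemma Ck_on_2I:
  fixes f :: "'a::euclidean_space \<Rightarrow> real"
  assumes S: "open S"
    and f: "\<And>x. x \<in> S \<Longrightarrow> (f has_derivative (\<lambda>v. N x \<bullet> v)) (at x)"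
    and N: "\<And>x. x \<in> S \<Longrightarrow> (N has_derivative H x) (at x)"
    and H: "\<And>v. continuous_on S (\<lambda>x. H x v)"
  shows "Ck_on 2 S f"
proof -
  have D: "((\<lambda>x. N x \<bullet> v) has_derivative (\<lambda>u. H x u \<bullet> v)) (at x)" if "x \<in> S" for x v
    by (rule has_derivative_inner_left[OF N[OF that]])
  have "Ck_on (Suc 0) S (\<lambda>x. N x \<bullet> v)" for v
    unfolding Ck_on.simps
  proof (intro conjI ballI allI)
    show "(\<lambda>x. N x \<bullet> v) differentiable at x" if "x \<in> S" for x
      using D[OF that] differentiable_def by blast
    show "continuous_on S (\<lambda>x. frechet_derivative (\<lambda>x. N x \<bullet> v) (at x) u)" for u
      by (subst continuous_on_cong[OF refl, where g = "\<lambda>x. H x u \<bullet> v"])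
        (auto simp: frechet_derivative_eqI[OF D] intro!: continuous_intros H)
  qed
  then have "Ck_on (Suc 0) S (\<lambda>x. frechet_derivative f (at x) v)" for v
    by (rule Ck_on_cong[OF S, rotated]) (simp add: frechet_derivative_eqI[OF f])
  then have "Ck_on (Suc (Suc 0)) S f"
    unfolding Ck_on.simps(2)[of "Suc 0"] using f differentiable_def by blast
  then show ?thesis by (simp add: numeral_2_eq_2)
qed

lemma has_derivative_gradient:
  assumes "f differentiable at x"
  shows "(f has_derivative (\<lambda>v. gradient f x \<bullet> v)) (at x)"
proof -
  have D: "(f has_derivative frechet_derivative f (at x)) (at x)"
    using assms by (simp add: frechet_derivative_works)
  then have "linear (frechet_derivative f (at x))"
    by (simp add: has_derivative_linear)
  then have "frechet_derivative f (at x) v = gradient f x \<bullet> v" for v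
    unfolding gradient_def inner_sum_left inner_scaleR_left
    by (subst (1) euclidean_representation[of v, symmetric])
      (simp add: linear_sum linear_scale inner_commute mult.commute)
  with D show ?thesis by (metis ext)
qed

lemma smooth_on_gradient:
  assumes "smooth_on S f" "open S"
  obtains H where "\<And>x. x \<in> S \<Longrightarrow> (f has_derivative (\<lambda>v. gradient f x \<bullet> v)) (at x)"
    "\<And>x. x \<in> S \<Longrightarrow> (gradient f has_derivative H x) (at x)"
    "\<And>v. continuous_on S (\<lambda>x. H x v)"
proof
  let ?D = "\<lambda>b x. frechet_derivative f (at x) b"
  have C: "Ck_on (Suc (Suc 0)) S f" using assms smooth_on_def by blast
  show "(f has_derivative (\<lambda>v. gradient f x \<bullet> v)) (at x)" if "x \<in> S" for x
    using C that by (simp add: has_derivative_gradient)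
  show "(gradient f has_derivative
      (\<lambda>u. \<Sum>b\<in>Basis. frechet_derivative (?D b) (at x) u *\<^sub>R b)) (at x)" if "x \<in> S" for x
    unfolding gradient_def[abs_def]
    by (intro has_derivative_sum has_derivative_scaleR_left)
      (use C that in \<open>simp add: frechet_derivative_works\<close>)
  show "continuous_on S (\<lambda>x. \<Sum>b\<in>Basis. frechet_derivative (?D b) (at x) v *\<^sub>R b)" for v
    by (intro continuous_intros) (use C in simp)
qed

section \<open>Wirtinger derivatives and the complex Hessian in real terms\<close>

lemma norm_vector_scalar_mult: "norm (c *s v) = norm c * norm (v :: complex ^ 'n)"
  by (simp add: norm_vec_def L2_set_right_distrib norm_mult)

lemma bounded_linear_vector_scalar_mult: "bounded_linear (\<lambda>c. c *s (v :: complex ^ 'n))"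
  by (rule bounded_linear_intro[where K = "norm v"])
    (simp_all add: vec_eq_iff algebra_simps norm_vector_scalar_mult)

text \<open>In the real inner product of \<open>complex ^ 'n\<close> the gradient has components
  \<open>N $ k = \<partial>f/\<partial>x_k + \<i> \<partial>f/\<partial>y_k\<close>, twice the
  derivative in the conjugate variable.\<close>

lemma deriv_z_of_real:
  fixes f :: "complex ^ 'n \<Rightarrow> real"
  assumes "(f has_derivative (\<lambda>v. N \<bullet> v)) (at x)"
  shows "deriv_z k (\<lambda>z. complex_of_real (f z)) x = cnj (N $ k) / 2"
    and "deriv_zbar k (\<lambda>z. complex_of_real (f z)) x = N $ k / 2"
proof -
  have "frechet_derivative (\<lambda>z. complex_of_real (f z)) (at x) = (\<lambda>v. of_real (N \<bullet> v))"
    by (rule frechet_derivative_eqI) (rule has_derivative_of_real[OF assms])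
  then show "deriv_z k (\<lambda>z. complex_of_real (f z)) x = cnj (N $ k) / 2"
    and "deriv_zbar k (\<lambda>z. complex_of_real (f z)) x = N $ k / 2"
    by (simp_all add: deriv_z_def deriv_zbar_def inner_axis complex_eq_iff inner_complex_def)
qed

text \<open>The right-hand side is a quarter of the Laplacian of
  \<open>\<tau> \<mapsto> f (z + \<tau> *s w)\<close> at \<open>0\<close>. In this form the complex
  Hessian can be handled by real calculus.\<close>

lemma Re_complex_hessian:
  fixes f :: "complex ^ 'n \<Rightarrow> real"
  assumes S: "open S" "z \<in> S"
    and f: "\<And>x. x \<in> S \<Longrightarrow> (f has_derivative (\<lambda>v. N x \<bullet> v)) (at x)"
    and N: "(N has_derivative H) (at z)"
  shows "Re (complex_hessian f z w w) = (H w \<bullet> w + H (\<i> *s w) \<bullet> (\<i> *s w)) / 4"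
proof -
  have lin: "linear H" using N by (rule has_derivative_linear)
  have w1: "w = (\<Sum>k\<in>UNIV. Re (w $ k) *\<^sub>R axis k 1 + Im (w $ k) *\<^sub>R axis k \<i>)"
    by (simp add: vec_eq_iff axis_def if_distrib complex_eq_iff cong: if_cong)
  have w2: "\<i> *s w = (\<Sum>k\<in>UNIV. Re (w $ k) *\<^sub>R axis k \<i> - Im (w $ k) *\<^sub>R axis k 1)"
    by (simp add: vec_eq_iff axis_def if_distrib complex_eq_iff sum_subtractf cong: if_cong)
  have H1: "H w = (\<Sum>k\<in>UNIV. Re (w $ k) *\<^sub>R H (axis k 1) + Im (w $ k) *\<^sub>R H (axis k \<i>))"
    by (subst w1) (simp add: linear_sum[OF lin] linear_add[OF lin] linear_scale[OF lin])
  have H2: "H (\<i> *s w) = (\<Sum>k\<in>UNIV. Re (w $ k) *\<^sub>R H (axis k \<i>) - Im (w $ k) *\<^sub>R H (axis k 1))"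
    by (subst w2) (simp add: linear_sum[OF lin] linear_diff[OF lin] linear_scale[OF lin])
  have D: "deriv_z k (deriv_zbar l (\<lambda>z. complex_of_real (f z))) z =
      (H (axis k 1) $ l - \<i> * H (axis k \<i>) $ l) / 4" for k l
  proof -
    have "((\<lambda>x. N x $ l / 2) has_derivative (\<lambda>v. H v $ l / 2)) (at z)"
      using bounded_linear.has_derivative[OF bounded_linear_vec_nth N]
      by (auto intro!: derivative_eq_intros)
    then have "(deriv_zbar l (\<lambda>z. complex_of_real (f z)) has_derivative (\<lambda>v. H v $ l / 2)) (at z)"
      by (rule has_derivative_transform_within_open[OF _ S]) (simp add: deriv_z_of_real[OF f])
    then show ?thesis
      by (simp add: deriv_z_def frechet_derivative_eqI field_simps)
  qed
  have "complex_hessian f z w w =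
      (\<Sum>l\<in>UNIV. (\<Sum>k\<in>UNIV. (H (axis k 1) $ l - \<i> * H (axis k \<i>) $ l) * w $ k) * cnj (w $ l) / 4)"
    unfolding complex_hessian_def D
    by (subst sum.swap) (simp add: sum_distrib_right sum_divide_distrib)
  also have "\<dots> = (\<Sum>l\<in>UNIV. (H w $ l - \<i> * H (\<i> *s w) $ l) * cnj (w $ l) / 4)"
  proof (intro sum.cong arg_cong2[where f = "(/)"] arg_cong2[where f = "(*)"] refl)
    show "(\<Sum>k\<in>UNIV. (H (axis k 1) $ l - \<i> * H (axis k \<i>) $ l) * w $ k)
        = H w $ l - \<i> * H (\<i> *s w) $ l" for l
      unfolding H1 H2
      by (simp add: sum_distrib_left flip: sum_subtractf)
        (rule sum.cong, simp_all add: complex_eq_iff algebra_simps)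
  qed
  finally have "Re (complex_hessian f z w w)
      = (\<Sum>l\<in>UNIV. Re ((H w $ l - \<i> * H (\<i> *s w) $ l) * cnj (w $ l) / 4))"
    by (simp only: Re_sum)
  then show ?thesis
    by (simp add: inner_vec_def inner_complex_def algebra_simps
        flip: sum.distrib sum_divide_distrib sum_subtractf)
qed

subsection \<open>The nearest point map\<close>

text \<open>In finite dimension, convergence on basis vectors is convergence in operator norm, which
  the inverse function theorem asks for.\<close>

lemma continuous_on_Blinfun:
  fixes D :: "'a::euclidean_space \<Rightarrow> 'b::euclidean_space \<Rightarrow> 'c::real_normed_vector"
  assumes "\<And>x. x \<in> S \<Longrightarrow> bounded_linear (D x)" "\<And>v. continuous_on S (\<lambda>x. D x v)"
  shows "continuous_on S (\<lambda>x. Blinfun (D x))"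
proof (rule continuous_on_blinfun_componentwise)
  show "continuous_on S (\<lambda>x. blinfun_apply (Blinfun (D x)) i)" for i
    by (subst continuous_on_cong[OF refl, where g = "\<lambda>x. D x i"])
      (auto simp: bounded_linear_Blinfun_apply assms)
qed

text \<open>A lower bound \<open>c * norm u\<close> for \<open>T x0\<close> persists with constant
  \<open>c / 2\<close> for nearby \<open>T x\<close>, and \<open>T x\<close> maps
  \<open>w x - w x0\<close> to \<open>(T x0 - T x) (w x0)\<close>, which tends to
  \<open>0\<close>.\<close>

lemma continuous_on_inv_blinfun:
  fixes T :: "'b::t2_space \<Rightarrow> ('a::euclidean_space \<Rightarrow>\<^sub>L 'a)"
  assumes T: "continuous_on S T" and b: "\<And>x. x \<in> S \<Longrightarrow> bij (blinfun_apply (T x))"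
  shows "continuous_on S (\<lambda>x. inv (blinfun_apply (T x)) v)"
  unfolding continuous_on_def
proof
  fix x0 assume x0: "x0 \<in> S"
  define w where "w x = inv (blinfun_apply (T x)) v" for x
  have Tw: "T x (w x) = v" if "x \<in> S" for x
    unfolding w_def using b[OF that] by (simp add: bij_is_surj surj_f_inv_f)
  obtain c where c: "c > 0" "\<And>u. c * norm u \<le> norm (T x0 u)"
    using linear_inj_bounded_below_pos[of "blinfun_apply (T x0)"] bij_is_inj[OF b[OF x0]]
    by (metis blinfun.bounded_linear_right bounded_linear.linear mult.commute)
  have lim: "(T \<longlongrightarrow> T x0) (at x0 within S)"
    using T x0 by (simp add: continuous_on_def)
  then have "\<forall>\<^sub>F x in at x0 within S. dist (T x) (T x0) < c / 2"
    using c(1) tendstoD half_gt_zero by blast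
  then have "\<forall>\<^sub>F x in at x0 within S.
      norm (w x - w x0) \<le> (2 / c) * norm ((T x0 - T x) (w x0))"
  proof (rule eventually_mp[rotated])
    show "\<forall>\<^sub>F x in at x0 within S. dist (T x) (T x0) < c / 2 \<longrightarrow>
      norm (w x - w x0) \<le> (2 / c) * norm ((T x0 - T x) (w x0))"
      unfolding eventually_at_filter
    proof (intro always_eventually allI impI)
      fix x assume "x \<in> S" and d: "dist (T x) (T x0) < c / 2"
      let ?u = "w x - w x0"
      have "T x ?u = (T x0 - T x) (w x0)"
        by (simp add: blinfun.bilinear_simps Tw \<open>x \<in> S\<close> x0)
      moreover have "c * norm ?u \<le> norm (T x0 ?u)" by (rule c)
      moreover have "norm (T x0 ?u) \<le> norm (T x ?u) + norm ((T x0 - T x) ?u)"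
        by (metis blinfun.diff_left norm_triangle_sub)
      moreover have "norm ((T x0 - T x) ?u) \<le> c / 2 * norm ?u"
        using d order_trans[OF norm_blinfun mult_right_mono]
        by (metis dist_commute dist_norm less_imp_le norm_ge_zero)
      ultimately have "c / 2 * norm ?u \<le> norm ((T x0 - T x) (w x0))" by simp
      then show "norm ?u \<le> (2 / c) * norm ((T x0 - T x) (w x0))"
        using c(1) by (simp add: field_simps)
    qed
  qed
  moreover have "((\<lambda>x. (2 / c) * norm ((T x0 - T x) (w x0))) \<longlongrightarrow> (2 / c) * norm ((T x0 - T x0) (w x0)))
      (at x0 within S)"
    by (intro tendsto_intros lim)
  ultimately have "((\<lambda>x. w x - w x0) \<longlongrightarrow> 0) (at x0 within S)"
    by (auto intro: Lim_null_comparison)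
  then show "((\<lambda>x. inv (blinfun_apply (T x)) v) \<longlongrightarrow> inv (blinfun_apply (T x0)) v) (at x0 within S)"
    unfolding w_def using Lim_null by blast
qed

text \<open>Adds to the inverse function theorem that the derivative of the inverse is again
  continuous. Injectivity of \<open>D x0\<close> supplies the required linear left inverse.\<close>

lemma inverse_function_C1:
  fixes f :: "'a::euclidean_space \<Rightarrow> 'a"
  assumes U: "open U" "x0 \<in> U"
    and f: "\<And>x. x \<in> U \<Longrightarrow> (f has_derivative D x) (at x)"
    and D: "\<And>v. continuous_on U (\<lambda>x. D x v)"
    and inj: "inj (D x0)"
  obtains U' V g g' where "open U'" "U' \<subseteq> U" "x0 \<in> U'" "open V" "f x0 \<in> V" "homeomorphism U' V f g"
    "\<And>y. y \<in> V \<Longrightarrow> (g has_derivative g' y) (at y)" "\<And>v. continuous_on V (\<lambda>y. g' y v)"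
proof -
  have bl: "bounded_linear (D x)" if "x \<in> U" for x
    using f[OF that] by (rule has_derivative_bounded_linear)
  obtain h where h: "linear h" "h \<circ> D x0 = id"
    using linear_injective_left_inverse[OF bounded_linear.linear[OF bl[OF U(2)]] inj] by blast
  have c: "continuous_on U (\<lambda>x. Blinfun (D x))"
    by (rule continuous_on_Blinfun[OF bl D])
  show thesis
  proof (rule inverse_function_theorem[OF U(1) _ c U(2)])
    show "(f has_derivative blinfun_apply (Blinfun (D x))) (at x)" if "x \<in> U" for x
      using f[OF that] bl[OF that] by (simp add: bounded_linear_Blinfun_apply)
    show "Blinfun h o\<^sub>L Blinfun (D x0) = id_blinfun"
      using h bl[OF U(2)]
      by (intro blinfun_eqI)
        (simp add: bounded_linear_Blinfun_apply linear_conv_bounded_linear fun_eq_iff)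
    fix U' V g g'
    assume *: "open U'" "U' \<subseteq> U" "x0 \<in> U'" "open V" "f x0 \<in> V" and hom: "homeomorphism U' V f g"
      and g: "\<And>y. y \<in> V \<Longrightarrow> (g has_derivative g' y) (at y)"
      and g': "\<And>y. y \<in> V \<Longrightarrow> g' y = inv (blinfun_apply (Blinfun (D (g y))))"
      and b: "\<And>y. y \<in> V \<Longrightarrow> bij (blinfun_apply (Blinfun (D (g y))))"
    have "g ` V \<subseteq> U" using hom \<open>U' \<subseteq> U\<close> by (auto simp: homeomorphism_def)
    then have "continuous_on V (\<lambda>y. Blinfun (D (g y)))"
      using hom by (intro continuous_on_compose2[OF c]) (auto simp: homeomorphism_def)
    then have "continuous_on V (\<lambda>y. g' y v)" for v
      using continuous_on_inv_blinfun[OF _ b, of V] by (simp add: g')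
    with * hom g show thesis by (rule that)
  qed
qed

section \<open>Frontier points nearest to a given point\<close>

text \<open>A ball is connected, so if it left \<open>S\<close> it would contain a frontier point,
  closer to \<open>z\<close> than the distance of \<open>z\<close> to the frontier.\<close>

lemma ball_infdist_frontier_subset:
  fixes z :: "'a::euclidean_space"
  assumes "z \<in> S"
  shows "ball z (infdist z (frontier S)) \<subseteq> S"
proof (rule ccontr)
  let ?B = "ball z (infdist z (frontier S))"
  assume n: "\<not> ?B \<subseteq> S"
  then have "?B \<noteq> {}" by blast
  then have "z \<in> ?B" by (simp add: not_le)
  then have "?B \<inter> S \<noteq> {}" using assms by blast
  moreover have "?B - S \<noteq> {}" using n by blast
  ultimately have "?B \<inter> frontier S \<noteq> {}"
    by (rule connected_Int_frontier[OF connected_ball])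
  then obtain x where "x \<in> ?B" "x \<in> frontier S" by blast
  then show False using infdist_le[of x "frontier S" z] by simp
qed

lemma nearest_frontier_point:
  fixes z :: "'a::euclidean_space"
  assumes "frontier S \<noteq> {}"
  obtains q where "q \<in> frontier S" "dist z q = infdist z (frontier S)"
proof -
  obtain q where "q \<in> frontier S" "\<And>y. y \<in> frontier S \<Longrightarrow> dist z q \<le> dist z y"
    using distance_attains_inf[OF frontier_closed assms] by metis
  then have "dist z q = infdist z (frontier S)"
    by (intro antisym infdist_le) (auto simp: infdist_notempty[OF assms] assms intro: cINF_greatest)
  with \<open>q \<in> frontier S\<close> show thesis by (rule that)
qed

text \<open>The value is not negative because the open set \<open>S\<close> misses \<open>q\<close>.
  It is not positive because \<open>r > 0\<close> would hold on a neighborhood free of points of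
  \<open>S\<close>, against \<open>q \<in> closure S\<close>.\<close>

lemma defining_function_frontier:
  fixes r :: "'a::euclidean_space \<Rightarrow> real"
  assumes "open S" "open U" "q \<in> U" "q \<in> frontier S" "continuous_on U r" "U \<inter> S = {x \<in> U. r x < 0}"
  shows "r q = 0"
proof (rule ccontr)
  assume "r q \<noteq> 0"
  moreover have "q \<notin> S" using assms(1,4) by (simp add: frontier_def interior_open)
  ultimately have "r q > 0" using assms(3,6) by force
  have "open (U \<inter> r -` {0<..})" 
    using continuous_open_preimage[OF assms(5,2)] by simp
  moreover have "q \<in> U \<inter> r -` {0<..}" using \<open>r q > 0\<close> assms(3) by simp
  moreover have "q \<in> closure S" using assms(4) by (simp add: frontier_def)
  ultimately have "S \<inter> (U \<inter> r -` {0<..}) \<noteq> {}"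
    using open_Int_closure_eq_empty[of "U \<inter> r -` {0<..}" S] by blast
  then obtain x where "x \<in> S" "x \<in> U" "r x > 0" by auto
  moreover have "x \<in> {x \<in> U. r x < 0}" using \<open>x \<in> S\<close> \<open>x \<in> U\<close> assms(6) by blast
  ultimately show False by simp
qed

text \<open>
  The ball around \<open>z\<close> through \<open>q\<close> lies in \<open>S\<close>, so \<open>r\<close> cannot increase along any direction that enters
  it from \<open>q\<close>; this forces \<open>n\<close> to be a multiple of \<open>z - q\<close>.
\<close>

lemma nearest_point_normal:
  fixes r :: "'a::euclidean_space \<Rightarrow> real"
  assumes S: "open S" "z \<in> S" and q: "q \<in> frontier S" "dist z q = infdist z (frontier S)"
    and U: "open U" "q \<in> U" "U \<inter> S = {x \<in> U. r x < 0}"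
    and r: "continuous_on U r" "(r has_derivative (\<lambda>v. n \<bullet> v)) (at q)" and n: "n \<noteq> 0"
  obtains t where "z - q = t *\<^sub>R n"
proof -
  define a where "a = z - q"
  have "q \<notin> S" using S q(1) by (simp add: frontier_def interior_open)
  then have "a \<noteq> 0" using S(2) a_def by auto
  have rq: "r q = 0" using defining_function_frontier S(1) U q(1) r(1) by blast
  have desc: "n \<bullet> v \<le> 0" if av: "a \<bullet> v > 0" for v
  proof -
    have "((\<lambda>s. r (q + s *\<^sub>R v)) has_real_derivative (n \<bullet> v)) (at 0)"
    proof -
      have "((\<lambda>s. q + s *\<^sub>R v) has_derivative (\<lambda>s. s *\<^sub>R v)) (at 0)"
        by (auto intro!: derivative_eq_intros)
      from has_derivative_compose[OF this, of r "\<lambda>v. n \<bullet> v"] r(2) show ?thesis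
        by (simp add: has_field_derivative_def mult_commute_abs)
    qed
    moreover have "\<forall>\<^sub>F s in at_right 0. r (q + s *\<^sub>R v) < 0"
    proof -
      have "((\<lambda>s. q + s *\<^sub>R v) \<longlongrightarrow> q + 0 *\<^sub>R v) (at_right 0)"
        by (intro tendsto_intros)
      then have "\<forall>\<^sub>F s in at_right 0. q + s *\<^sub>R v \<in> U"
        using U(1,2) by (intro topological_tendstoD) auto
      \<comment> \<open>For such \<open>s > 0\<close> the point \<open>q + s *\<^sub>R v\<close> is
        strictly closer to \<open>z\<close> than \<open>q\<close> is.\<close>
      moreover have "\<forall>\<^sub>F s in at_right 0. s * (norm v)\<^sup>2 < 2 * (a \<bullet> v)"
        by (rule order_tendstoD(2)[where y = 0]) (auto intro!: tendsto_eq_intros simp: av)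
      ultimately show ?thesis using eventually_at_right_less[of 0]
      proof eventually_elim
        case (elim s)
        have "(norm (a - s *\<^sub>R v))\<^sup>2 = (norm a)\<^sup>2 - s * (2 * (a \<bullet> v) - s * (norm v)\<^sup>2)"
          by (simp add: power2_norm_eq_inner inner_diff_left inner_diff_right inner_commute algebra_simps)
        also have "\<dots> < (norm a)\<^sup>2" using elim by simp
        finally have "norm (a - s *\<^sub>R v) < norm a" by (rule power2_less_imp_less) simp
        then have "q + s *\<^sub>R v \<in> ball z (infdist z (frontier S))"
          by (simp add: q(2)[symmetric] dist_norm a_def algebra_simps)
        then have "q + s *\<^sub>R v \<in> S" using ball_infdist_frontier_subset[OF S(2)] by blast
        then show ?case using elim(1) U(3) by blast
      qed
    qed
    ultimately show ?thesis
    proof (rule_tac ccontr)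
      assume D: "((\<lambda>s. r (q + s *\<^sub>R v)) has_real_derivative (n \<bullet> v)) (at 0)"
        and ev: "\<forall>\<^sub>F s in at_right 0. r (q + s *\<^sub>R v) < 0" and "\<not> n \<bullet> v \<le> 0"
      then obtain d where "d > 0" "\<And>h. 0 < h \<Longrightarrow> h < d \<Longrightarrow> r (q + 0 *\<^sub>R v) < r (q + (0 + h) *\<^sub>R v)"
        using DERIV_pos_inc_right[OF D] by auto
      moreover obtain b where "b > 0" "\<And>s. 0 < s \<Longrightarrow> s < b \<Longrightarrow> r (q + s *\<^sub>R v) < 0"
        using ev by (auto simp: eventually_at_right_field)
      ultimately show False
        using rq by (metis add.right_neutral add_0 field_lbound_gt_zero order_less_asym scaleR_zero_left)
    qed
  qed
  \<comment> \<open>The component of \<open>n\<close> orthogonal to \<open>a\<close>. Since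
    \<open>desc\<close> needs a strictly positive product with \<open>a\<close>, it is applied to
    \<open>u + e *\<^sub>R a\<close>; letting \<open>e\<close> tend to \<open>0\<close> gives
    \<open>u \<bullet> u \<le> 0\<close>.\<close>
  define u where "u = n - ((n \<bullet> a) / (a \<bullet> a)) *\<^sub>R a"
  have aa: "a \<bullet> a > 0" using \<open>a \<noteq> 0\<close> by simp
  have ua: "u \<bullet> a = 0" using aa by (simp add: u_def inner_diff_left)
  have nu: "n \<bullet> u = u \<bullet> u" using ua by (simp add: u_def inner_diff_left inner_diff_right inner_commute)
  have "n \<bullet> u + e * (n \<bullet> a) \<le> 0" if "e > 0" for e
    using desc[of "u + e *\<^sub>R a"] that aa ua by (simp add: inner_add_right inner_commute)
  then have "\<forall>\<^sub>F e in at_right 0. n \<bullet> u + e * (n \<bullet> a) \<le> 0"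
    using eventually_at_right_less by (rule eventually_mono[rotated])
  moreover have "((\<lambda>e. n \<bullet> u + e * (n \<bullet> a)) \<longlongrightarrow> n \<bullet> u) (at_right 0)"
    by (auto intro!: tendsto_eq_intros)
  ultimately have "n \<bullet> u \<le> 0"
    by (rule tendsto_upperbound[OF _ _ trivial_limit_at_right_real, rotated])
  then have "u \<bullet> u \<le> 0" by (simp only: nu)
  then have "u \<bullet> u = 0" using inner_ge_zero[of u] by linarith
  then have "u = 0" by simp
  define c where "c = (n \<bullet> a) / (a \<bullet> a)"
  have na: "n = c *\<^sub>R a" using \<open>u = 0\<close> by (simp add: u_def c_def)
  then have "c \<noteq> 0" using n by auto
  then have "z - q = (1 / c) *\<^sub>R n" by (simp add: na a_def)
  then show thesis by (rule that)
qed

text \<open>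
  By \<open>nearest_point_normal\<close> the nearest point \<open>q\<close> solves \<open>q + t N(q) = z\<close>, \<open>r(q) = 0\<close> with small \<open>t\<close>, and
  the map \<open>(q, t) \<mapsto> (q + t N(q), r(q))\<close> is invertible near \<open>(p, 0)\<close>.
\<close>

lemma nearest_point_C1:
  fixes r :: "'a::euclidean_space \<Rightarrow> real"
  assumes S: "open S" "p \<in> frontier S"
    and U: "open U" "p \<in> U" "U \<inter> S = {x \<in> U. r x < 0}"
    and r: "\<And>x. x \<in> U \<Longrightarrow> (r has_derivative (\<lambda>v. N x \<bullet> v)) (at x)"
    and N: "\<And>x. x \<in> U \<Longrightarrow> (N has_derivative H x) (at x)" "\<And>x. x \<in> U \<Longrightarrow> N x \<noteq> 0"
    and H: "\<And>v. continuous_on U (\<lambda>x. H x v)"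
  obtains W y y' where "open W" "p \<in> W" "\<And>z. z \<in> W \<Longrightarrow> (y has_derivative y' z) (at z)"
    "\<And>v. continuous_on W (\<lambda>z. y' z v)"
    "\<And>z. z \<in> W \<inter> S \<Longrightarrow> y z \<in> frontier S \<and> dist z (y z) = infdist z (frontier S)"
proof -
  have rc: "continuous_on U r" and Nc: "continuous_on U N"
    by (auto intro!: continuous_at_imp_continuous_on has_derivative_continuous r N(1))
  have rp: "r p = 0" by (rule defining_function_frontier[OF S(1) U(1,2) S(2) rc U(3)])
  define F where "F x = (fst x + snd x *\<^sub>R N (fst x), r (fst x))" for x :: "'a \<times> real"
  define D where "D x v = (fst v + (snd v *\<^sub>R N (fst x) + snd x *\<^sub>R H (fst x) (fst v)), N (fst x) \<bullet> fst v)"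
    for x v :: "'a \<times> real"
  have F: "(F has_derivative D x) (at x)" if "x \<in> U \<times> UNIV" for x
  proof -
    have x: "fst x \<in> U" using that by auto
    have f: "(fst has_derivative fst) (at x)" by (intro bounded_linear_imp_has_derivative bounded_linear_fst bounded_linear_snd)
    have s: "(snd has_derivative snd) (at x)" by (intro bounded_linear_imp_has_derivative bounded_linear_fst bounded_linear_snd)
    have "((\<lambda>x. fst x + snd x *\<^sub>R N (fst x)) has_derivative
        (\<lambda>v. fst v + (snd x *\<^sub>R H (fst x) (fst v) + snd v *\<^sub>R N (fst x)))) (at x)"
      by (intro has_derivative_add f has_derivative_scaleR s has_derivative_compose[OF f N(1)[OF x]])
    moreover have "((\<lambda>x. r (fst x)) has_derivative (\<lambda>v. N (fst x) \<bullet> fst v)) (at x)"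
      by (rule has_derivative_compose[OF f r[OF x]])
    ultimately show ?thesis
      unfolding F_def D_def by (simp add: has_derivative_Pair add.commute)
  qed
  have D: "continuous_on (U \<times> UNIV) (\<lambda>x. D x v)" for v
    unfolding D_def
    by (intro continuous_intros continuous_on_compose2[OF Nc] continuous_on_compose2[OF H]) auto
  have "linear (D (p, 0))" by (rule has_derivative_linear[OF F]) (simp add: U)
  moreover have "v = 0" if "D (p, 0) v = 0" for v
  proof -
    have 1: "fst v + snd v *\<^sub>R N p = 0" "N p \<bullet> fst v = 0" using that by (auto simp: D_def zero_prod_def)
    then have "N p \<bullet> (fst v + snd v *\<^sub>R N p) = 0" by simp
    then have "snd v = 0" using N(2)[OF U(2)] 1(2) by (simp add: inner_add_right)
    with 1 show "v = 0" by (simp add: prod_eq_iff)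
  qed
  ultimately have inj: "inj (D (p, 0))" by (simp add: linear_injective_0)
  have mem: "(p, 0) \<in> U \<times> UNIV" using U(2) by simp
  obtain U' V g g' where U': "open U'" "U' \<subseteq> U \<times> UNIV" "(p, 0) \<in> U'" and V: "open V" "F (p, 0) \<in> V"
    and hom: "homeomorphism U' V F g"
    and g: "\<And>y. y \<in> V \<Longrightarrow> (g has_derivative g' y) (at y)" "\<And>v. continuous_on V (\<lambda>y. g' y v)"
    by (rule inverse_function_C1[OF open_Times[OF U(1) open_UNIV] mem F D inj]) (assumption, blast intro: that)
  obtain A B where AB: "open A" "open B" "p \<in> A" "0 \<in> B" "A \<times> B \<subseteq> U'"
    using open_prod_elim[OF U'(1,3)] by (metis mem_Sigma_iff)
  obtain e where e: "e > 0" "ball 0 e \<subseteq> B" using AB(2,4) openE by blast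
  have Np: "norm (N p) > 0" using N(2) U(2) by simp
  have "isCont N p" using Nc U by (simp add: continuous_on_eq_continuous_at)
  then have "\<forall>\<^sub>F q in nhds p. norm (N q) > norm (N p) / 2"
    using Np order_tendstoD(1)[OF tendsto_norm, of N "N p" "nhds p" "norm (N p) / 2"]
    by (simp add: isCont_def tendsto_at_iff_tendsto_nhds)
  then have "\<forall>\<^sub>F q in nhds p. norm (N q) > norm (N p) / 2 \<and> q \<in> A \<and> q \<in> U"
    using AB U by (intro eventually_conj eventually_nhds_in_open)
  then obtain d where d: "d > 0"
    "\<And>q. dist q p < d \<Longrightarrow> norm (N q) > norm (N p) / 2 \<and> q \<in> A \<and> q \<in> U"
    by (auto simp: eventually_nhds_metric)
  \<comment> \<open>The radius \<open>d / 2\<close> keeps every nearest point within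
    \<open>d\<close> of \<open>p\<close>, because it is no farther from \<open>z\<close> than
    \<open>p\<close> is. The radius \<open>e * norm (N p) / 2\<close> forces
    \<open>\<bar>t\<bar> < e\<close>, because \<open>norm (N q) > norm (N p) / 2\<close>
    there.\<close>
  define W where "W = (\<lambda>z. (z, 0)) -` V \<inter> ball p (min (d / 2) (e * norm (N p) / 2))"
  have WV: "(z, 0) \<in> V" if "z \<in> W" for z using that W_def by simp
  show thesis
  proof
    show "open W"
      unfolding W_def by (intro open_Int open_vimage V open_ball) (intro continuous_intros)
    show "p \<in> W" using V(2) rp d e Np by (simp add: W_def F_def)
    show "((\<lambda>z. fst (g (z, 0))) has_derivative (\<lambda>v. fst (g' (z, 0) (v, 0)))) (at z)" if "z \<in> W" for z
    proof -
      have "((\<lambda>z::'a. (z, 0::real)) has_derivative (\<lambda>v. (v, 0))) (at z)"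
        by (intro derivative_intros)
      from has_derivative_compose[OF this g(1)[OF WV[OF that]]] show ?thesis
        by (rule has_derivative_fst)
    qed
    show "continuous_on W (\<lambda>z. fst (g' (z, 0) (v, 0)))" for v
      by (intro continuous_on_fst continuous_on_compose2[OF g(2)] continuous_intros) (auto simp: WV)
    show "fst (g (z, 0)) \<in> frontier S \<and> dist z (fst (g (z, 0))) = infdist z (frontier S)"
      if "z \<in> W \<inter> S" for z
    proof -
      have zS: "z \<in> S" using that by blast
      \<comment> \<open>An arbitrary nearest point is taken. It solves
        \<open>F (q, t) = (z, 0)\<close> inside the domain of the local inverse, so it must be
        \<open>fst (g (z, 0))\<close>.\<close>
      obtain q where q: "q \<in> frontier S" "dist z q = infdist z (frontier S)"
        using nearest_frontier_point S(2) by blast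
      have zp: "dist z p < d / 2" "dist z p < e * norm (N p) / 2"
        using that by (auto simp: W_def dist_commute)
      have zq: "dist z q \<le> dist z p" unfolding q(2) by (rule infdist_le[OF S(2)])
      then have "dist q p < d" using zp dist_triangle[of q p z] by (simp add: dist_commute)
      note q' = d(2)[OF this]
      obtain t where t: "z - q = t *\<^sub>R N q"
        by (rule nearest_point_normal[OF S(1) _ q U(1) _ U(3) rc r]) (use zS q' N(2) in auto)
      have "\<bar>t\<bar> * norm (N q) = dist z q" by (simp add: dist_norm t)
      also have "\<dots> < e * (norm (N p) / 2)" using zq zp by simp
      also have "\<dots> < e * norm (N q)" using q' e(1) by simp
      finally have "t \<in> ball 0 e" by (simp add: mult_less_cancel_right)
      then have "(q, t) \<in> A \<times> B" using e(2) q' by blast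
      then have "(q, t) \<in> U'" using AB(5) by (rule subsetD[rotated])
      then have "g (F (q, t)) = (q, t)" by (rule homeomorphism_apply1[OF hom])
      moreover have "q \<in> U" using q' by simp
      then have "r q = 0" by (rule defining_function_frontier[OF S(1) U(1) _ q(1) rc U(3)])
      then have "F (q, t) = (z, 0)" by (simp add: F_def t[symmetric])
      ultimately have "g (z, 0) = (q, t)" by simp
      then show ?thesis using q by simp
    qed
  qed
qed

text \<open>
  Comparing with the competitors \<open>y z\<close> for \<open>z + h\<close> and \<open>y (z + h)\<close> for \<open>z\<close> bounds the increment of the
  squared distance on both sides, so continuity of \<open>y\<close> is enough.
\<close>

lemma infdist_sq_has_derivative:
  fixes y :: "'a::euclidean_space \<Rightarrow> 'a"
  assumes W: "open W" "z \<in> W" and y: "isCont y z"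
    and near: "\<And>x. x \<in> W \<Longrightarrow> y x \<in> C \<and> dist x (y x) = infdist x C"
  shows "((\<lambda>x. (infdist x C)\<^sup>2) has_derivative (\<lambda>v. (2 *\<^sub>R (z - y z)) \<bullet> v)) (at z)"
  unfolding has_derivative_at
proof (intro conjI bounded_linear_inner_right)
  let ?R = "\<lambda>h. norm ((infdist (z + h) C)\<^sup>2 - (infdist z C)\<^sup>2 - (2 *\<^sub>R (z - y z)) \<bullet> h)"
  have "((\<lambda>h. z + h) \<longlongrightarrow> z + 0) (at 0)" by (intro tendsto_intros)
  then have lim: "((\<lambda>h. z + h) \<longlongrightarrow> z) (at 0)" by simp
  have "((\<lambda>h. y (z + h)) \<longlongrightarrow> y z) (at 0)" by (rule isCont_tendsto_compose[OF y lim])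
  then have "((\<lambda>h. norm h + 2 * norm (y (z + h) - y z)) \<longlongrightarrow> norm (0::'a) + 2 * norm (y z - y z)) (at 0)"
    by (intro tendsto_intros)
  then have "((\<lambda>h. norm h + 2 * norm (y (z + h) - y z)) \<longlongrightarrow> 0) (at 0)" by simp
  moreover have "\<forall>\<^sub>F h in at 0. norm (?R h / norm h) \<le> norm h + 2 * norm (y (z + h) - y z)"
  proof -
    have "\<forall>\<^sub>F h in at 0. z + h \<in> W" using topological_tendstoD[OF lim W] .
    then show ?thesis
    proof eventually_elim
      case (elim h)
      let ?k = "y (z + h) - y z"
      have sq: "(infdist x C)\<^sup>2 \<le> (x - c) \<bullet> (x - c)" if "c \<in> C" for x c
        using infdist_le[OF that, of x] infdist_nonneg[of x C]
        by (simp add: dist_norm flip: power2_norm_eq_inner)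
      have eq: "(infdist x C)\<^sup>2 = (x - y x) \<bullet> (x - y x)" if "x \<in> W" for x
        using near[OF that] by (simp flip: dist_norm power2_norm_eq_inner)
      have "(infdist (z + h) C)\<^sup>2 \<le> (z + h - y z) \<bullet> (z + h - y z)"
        using sq near W(2) by blast
      then have 1: "(infdist (z + h) C)\<^sup>2 - (infdist z C)\<^sup>2 - (2 *\<^sub>R (z - y z)) \<bullet> h \<le> h \<bullet> h"
        by (simp add: eq[OF W(2)] inner_simps inner_commute)
      have "(infdist z C)\<^sup>2 \<le> (z - y (z + h)) \<bullet> (z - y (z + h))"
        using sq near elim by blast
      then have 2: "h \<bullet> h - 2 * (?k \<bullet> h)
          \<le> (infdist (z + h) C)\<^sup>2 - (infdist z C)\<^sup>2 - (2 *\<^sub>R (z - y z)) \<bullet> h"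
        by (simp add: eq[OF elim] inner_simps inner_commute)
      have 3: "\<bar>?k \<bullet> h\<bar> \<le> norm ?k * norm h" by (rule Cauchy_Schwarz_ineq2)
      have "?R h \<le> h \<bullet> h + 2 * (norm ?k * norm h)"
        using 1 2 3 inner_ge_zero[of h] unfolding real_norm_def by linarith
      then have "?R h \<le> (norm h + 2 * norm ?k) * norm h"
        by (simp add: algebra_simps dot_square_norm power2_eq_square)
      then have "?R h / norm h \<le> norm h + 2 * norm ?k"
        by (cases "h = 0") (auto simp: divide_simps)
      then show ?case by simp
    qed
  qed
  ultimately show "((\<lambda>h. ?R h / norm h) \<longlongrightarrow> 0) (at 0)"
    by (rule Lim_null_comparison[rotated])
qed

text \<open>The gradient \<open>2 (z - y z)\<close> of the squared distance contains
  \<open>y\<close> undifferentiated, so one continuous derivative of \<open>y\<close> yields two of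
  the squared distance \<open>g\<close>, and hence of \<open>- ln g / 2\<close>.\<close>

lemma neg_ln_infdist_derivatives:
  fixes y :: "'a::euclidean_space \<Rightarrow> 'a"
  assumes W: "open W" and y: "\<And>z. z \<in> W \<Longrightarrow> (y has_derivative y' z) (at z)"
    and y': "\<And>v. continuous_on W (\<lambda>z. y' z v)"
    and near: "\<And>z. z \<in> W \<Longrightarrow> y z \<in> C \<and> dist z (y z) = infdist z C"
    and pos: "\<And>z. z \<in> W \<Longrightarrow> infdist z C > 0"
  obtains N H where
    "\<And>z. z \<in> W \<Longrightarrow> ((\<lambda>x. - ln (infdist x C)) has_derivative (\<lambda>v. N z \<bullet> v)) (at z)"
    "\<And>z. z \<in> W \<Longrightarrow> (N has_derivative H z) (at z)" "\<And>v. continuous_on W (\<lambda>z. H z v)"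
proof
  define g where "g x = (infdist x C)\<^sup>2" for x
  have gpos: "g z > 0" if "z \<in> W" for z using pos[OF that] by (simp add: g_def)
  have yc: "isCont y z" if "z \<in> W" for z using y[OF that] by (rule has_derivative_continuous)
  have g: "(g has_derivative (\<lambda>v. (2 *\<^sub>R (z - y z)) \<bullet> v)) (at z)" if "z \<in> W" for z
    unfolding g_def[abs_def] by (rule infdist_sq_has_derivative[OF W that yc[OF that] near])
  have cont: "continuous_on W y" "continuous_on W g"
    using yc has_derivative_continuous[OF g] by (auto intro: continuous_at_imp_continuous_on)
  let ?N = "\<lambda>x. (- inverse (g x)) *\<^sub>R (x - y x)"
  show "((\<lambda>x. - ln (infdist x C)) has_derivative (\<lambda>v. ?N z \<bullet> v)) (at z)" if "z \<in> W" for z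
  proof -
    have "((\<lambda>x. - (ln (g x) / 2)) has_derivative (\<lambda>v. ?N z \<bullet> v)) (at z)"
      using gpos[OF that]
      by (auto intro!: derivative_eq_intros g[OF that] simp: fun_eq_iff inner_simps field_simps)
    then show ?thesis
    proof (rule has_derivative_transform_within_open[OF _ W that])
      show "- (ln (g x) / 2) = - ln (infdist x C)" if "x \<in> W" for x
        using pos[OF that] by (simp add: g_def ln_realpow)
    qed
  qed
  let ?H = "\<lambda>z v. (- inverse (g z)) *\<^sub>R (v - y' z v) +
      (inverse (g z) * ((2 *\<^sub>R (z - y z)) \<bullet> v) * inverse (g z)) *\<^sub>R (z - y z)"
  show "(?N has_derivative ?H z) (at z)" if "z \<in> W" for z
    using gpos[OF that]
    by (intro has_derivative_eq_rhs[OF has_derivative_scaleR[OF has_derivative_minus[OF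
              Deriv.has_derivative_inverse[OF _ g[OF that]]] has_derivative_diff[OF has_derivative_ident y[OF that]]]])
      auto
  show "continuous_on W (\<lambda>z. ?H z v)" for v
    by (intro continuous_intros cont y') (use gpos in force)+
qed

subsection \<open>Second-order expansions\<close>

text \<open>
  The mean value theorem is applied on each ray, where only \<open>H h \<bullet> h\<close> enters; differentiating the
  remainder in \<open>h\<close> would require the symmetry of \<open>H\<close>.
\<close>

lemma second_order_Taylor:
  fixes f :: "'a::euclidean_space \<Rightarrow> real"
  assumes S: "open S" "z \<in> S"
    and f: "\<And>x. x \<in> S \<Longrightarrow> (f has_derivative (\<lambda>v. N x \<bullet> v)) (at x)"
    and N: "(N has_derivative H) (at z)" and e: "e > 0"
  obtains d where "d > 0"
    "\<And>h. norm h < d \<Longrightarrow> \<bar>f (z + h) - f z - N z \<bullet> h - H h \<bullet> h / 2\<bar> \<le> e * (norm h)\<^sup>2"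
proof -
  have lin: "linear H" using N by (rule has_derivative_linear)
  obtain d1 where d1: "d1 > 0" "\<And>x. norm (x - z) < d1 \<Longrightarrow> norm (N x - N z - H (x - z)) \<le> e * norm (x - z)"
    using N e unfolding has_derivative_at_alt by blast
  obtain d2 where d2: "d2 > 0" "ball z d2 \<subseteq> S" using S openE by blast
  show thesis
  proof
    show "min d1 d2 > 0" using d1 d2 by simp
    fix h :: 'a assume h: "norm h < min d1 d2"
    have small: "norm (s *\<^sub>R h) < min d1 d2" if "0 \<le> s" "s \<le> 1" for s
      using that h by (simp add: mult_left_le_one_le order_le_less_trans[of _ "norm h"])
    \<comment> \<open>Along the ray, \<open>f\<close> minus the linear and quadratic Taylor terms;
      its increment over \<open>[0, 1]\<close> is the remainder to be estimated.\<close>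
    let ?\<phi> = "\<lambda>s. f (z + s *\<^sub>R h) - s * (N z \<bullet> h) - s\<^sup>2 * (H h \<bullet> h / 2)"
    let ?\<phi>' = "\<lambda>s. N (z + s *\<^sub>R h) \<bullet> h - N z \<bullet> h - 2 * s * (H h \<bullet> h / 2)"
    have "(?\<phi> has_real_derivative ?\<phi>' s) (at s)" if "0 \<le> s" "s \<le> 1" for s
    proof -
      have "z + s *\<^sub>R h \<in> S" using small[OF that] d2(2) by (auto simp: dist_norm)
      moreover have "((\<lambda>s. z + s *\<^sub>R h) has_derivative (\<lambda>s. s *\<^sub>R h)) (at s)"
        by (auto intro!: derivative_eq_intros)
      ultimately have "((\<lambda>s. f (z + s *\<^sub>R h)) has_real_derivative N (z + s *\<^sub>R h) \<bullet> h) (at s)"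
        using has_derivative_compose[OF _ f] by (force simp: has_field_derivative_def mult_commute_abs)
      then show ?thesis by (auto intro!: derivative_eq_intros)
    qed
    then obtain s where s: "0 < s" "s < 1" "?\<phi> 1 - ?\<phi> 0 = (1 - 0) * ?\<phi>' s"
      using MVT2[of 0 1 ?\<phi> ?\<phi>'] by auto
    have "f (z + h) - f z - N z \<bullet> h - H h \<bullet> h / 2 = ?\<phi>' s" using s(3) by simp
    also have "\<dots> = (N (z + s *\<^sub>R h) - N z - H (s *\<^sub>R h)) \<bullet> h"
      by (simp add: inner_diff_left linear_scale[OF lin])
    also have "\<bar>\<dots>\<bar> \<le> norm (N (z + s *\<^sub>R h) - N z - H (s *\<^sub>R h)) * norm h"
      by (rule Cauchy_Schwarz_ineq2)
    also have "\<dots> \<le> (e * norm (s *\<^sub>R h)) * norm h"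
      using d1(2)[of "z + s *\<^sub>R h"] small[of s] s by (intro mult_right_mono) auto
    also have "\<dots> \<le> (e * norm h) * norm h"
      using s e by (intro mult_right_mono mult_left_mono) (auto simp: mult_left_le_one_le)
    finally show "\<bar>f (z + h) - f z - N z \<bullet> h - H h \<bullet> h / 2\<bar> \<le> e * (norm h)\<^sup>2"
      by (simp add: power2_eq_square mult.assoc)
  qed
qed

text \<open>Along \<open>\<gamma> t = q + t a + t^2 b + o(t^2)\<close> the function \<open>r\<close>
  has first-order coefficient \<open>N q \<bullet> a\<close> and second-order coefficient
  \<open>N q \<bullet> b + H a \<bullet> a / 2\<close>. The maximum at \<open>0\<close> makes the
  first vanish, and the quadratic drop bounds the second.\<close>

lemma second_derivative_test_curve:
  fixes r :: "'a::euclidean_space \<Rightarrow> real" and \<gamma> :: "real \<Rightarrow> 'a"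
  assumes U: "open U" "q \<in> U"
    and r: "\<And>x. x \<in> U \<Longrightarrow> (r has_derivative (\<lambda>v. N x \<bullet> v)) (at x)"
    and N: "(N has_derivative H) (at q)"
    and \<gamma>: "\<gamma> 0 = q" "(\<gamma> has_vector_derivative a) (at 0)"
      "((\<lambda>t. (\<gamma> t - q - t *\<^sub>R a) /\<^sub>R t\<^sup>2) \<longlongrightarrow> b) (at 0)"
    and max: "\<forall>\<^sub>F t in at 0. r (\<gamma> t) \<le> r q - k * t\<^sup>2" "k \<ge> 0"
  shows "N q \<bullet> a = 0" and "N q \<bullet> b + H a \<bullet> a / 2 \<le> - k"
proof -
  have D: "((\<lambda>t. r (\<gamma> t)) has_real_derivative N q \<bullet> a) (at 0)"
    using has_derivative_compose[OF \<gamma>(2)[unfolded has_vector_derivative_def], of r "\<lambda>v. N q \<bullet> v"] r[OF U(2)] \<gamma>(1)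
    by (simp add: has_field_derivative_def mult_commute_abs)
  obtain d where "d > 0" "\<And>t. t \<noteq> 0 \<Longrightarrow> \<bar>t\<bar> < d \<Longrightarrow> r (\<gamma> t) \<le> r q - k * t\<^sup>2"
    using max(1) by (auto simp: eventually_at)
  then have "\<forall>t. \<bar>0 - t\<bar> < d \<longrightarrow> r (\<gamma> t) \<le> r (\<gamma> 0)"
    using \<gamma>(1) max(2) by (metis abs_minus_commute diff_zero diff_ge_0_iff_ge order_refl order_trans
      diff_le_eq le_add_same_cancel1 mult_nonneg_nonneg zero_le_power2)
  with D \<open>d > 0\<close> show Na: "N q \<bullet> a = 0" by (rule DERIV_local_max)
  have lin: "linear H" and bl: "bounded_linear H"
    using N has_derivative_linear has_derivative_bounded_linear by blast+
  \<comment> \<open>For \<open>t \<noteq> 0\<close> the displacement from \<open>q\<close> is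
    \<open>t *\<^sub>R x t\<close> with \<open>x t\<close> tending to \<open>a\<close>. As
    \<open>N q \<bullet> a = 0\<close>, its product with \<open>N q\<close> is
    \<open>t^2 * (N q \<bullet> c t)\<close>, so the Taylor estimate can be divided by
    \<open>t^2\<close>.\<close>
  define c where "c t = (\<gamma> t - q - t *\<^sub>R a) /\<^sub>R t\<^sup>2" for t
  define x where "x t = a + t *\<^sub>R c t" for t
  have c: "(c \<longlongrightarrow> b) (at 0)" using \<gamma>(3) by (simp add: c_def[abs_def])
  have "(x \<longlongrightarrow> a + 0 *\<^sub>R b) (at 0)"
    unfolding x_def[abs_def] by (intro tendsto_intros c)
  then have x: "(x \<longlongrightarrow> a) (at 0)" by simp
  have \<gamma>x: "\<gamma> t = q + t *\<^sub>R x t" if "t \<noteq> 0" for t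
  proof -
    have "t * (t * inverse (t\<^sup>2)) = 1" using that by (simp add: power2_eq_square field_simps)
    then show ?thesis by (simp add: x_def c_def scaleR_add_right)
  qed
  have "((\<lambda>t. t *\<^sub>R x t) \<longlongrightarrow> 0 *\<^sub>R a) (at 0)" by (intro tendsto_intros x)
  then have tx: "((\<lambda>t. t *\<^sub>R x t) \<longlongrightarrow> 0) (at 0)" by simp
  have bound: "N q \<bullet> b + H a \<bullet> a / 2 - e * (norm a)\<^sup>2 \<le> - k" if "e > 0" for e
  proof -
    obtain d where d: "d > 0"
      "\<And>h. norm h < d \<Longrightarrow> \<bar>r (q + h) - r q - N q \<bullet> h - H h \<bullet> h / 2\<bar> \<le> e * (norm h)\<^sup>2"
      using second_order_Taylor[OF U r N \<open>e > 0\<close>] by blast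
    have "\<forall>\<^sub>F t in at 0. norm (t *\<^sub>R x t) < d"
      using tendstoD[OF tx d(1)] by simp
    moreover have "\<forall>\<^sub>F t in at (0::real). t \<noteq> 0" by (simp add: eventually_at_filter)
    ultimately have "\<forall>\<^sub>F t in at 0. N q \<bullet> c t + H (x t) \<bullet> x t / 2 - e * (norm (x t))\<^sup>2 \<le> - k"
      using max(1)
    proof eventually_elim
      case (elim t)
      have "r q + N q \<bullet> (t *\<^sub>R x t) + H (t *\<^sub>R x t) \<bullet> (t *\<^sub>R x t) / 2 - e * (norm (t *\<^sub>R x t))\<^sup>2
          \<le> r q - k * t\<^sup>2"
        using d(2)[OF elim(1)] elim(3) \<gamma>x[OF elim(2)] by simp
      moreover have "N q \<bullet> (t *\<^sub>R x t) = t\<^sup>2 * (N q \<bullet> c t)"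
        by (simp add: x_def inner_add_right Na power2_eq_square)
      moreover have "H (t *\<^sub>R x t) \<bullet> (t *\<^sub>R x t) = t\<^sup>2 * (H (x t) \<bullet> x t)"
        "(norm (t *\<^sub>R x t))\<^sup>2 = t\<^sup>2 * (norm (x t))\<^sup>2"
        by (simp_all add: linear_scale[OF lin] power2_eq_square abs_mult_self_eq algebra_simps)
      ultimately have "t\<^sup>2 * (N q \<bullet> c t + H (x t) \<bullet> x t / 2 - e * (norm (x t))\<^sup>2) \<le> t\<^sup>2 * (- k)"
        by (simp only:) (simp add: algebra_simps)
      then show ?case by (rule mult_left_le_imp_le) (use elim(2) in simp)
    qed
    moreover have "((\<lambda>t. N q \<bullet> c t + H (x t) \<bullet> x t / 2 - e * (norm (x t))\<^sup>2)
        \<longlongrightarrow> N q \<bullet> b + H a \<bullet> a / 2 - e * (norm a)\<^sup>2) (at 0)"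
      by (intro tendsto_intros c x bounded_linear.tendsto[OF bl]) simp
    ultimately show ?thesis
      by (rule tendsto_upperbound[OF _ _ trivial_limit_at, rotated])
  qed
  have "((\<lambda>e. N q \<bullet> b + H a \<bullet> a / 2 - e * (norm a)\<^sup>2) \<longlongrightarrow> N q \<bullet> b + H a \<bullet> a / 2) (at_right 0)"
    by (auto intro!: tendsto_eq_intros)
  moreover have "\<forall>\<^sub>F e in at_right 0. N q \<bullet> b + H a \<bullet> a / 2 - e * (norm a)\<^sup>2 \<le> - k"
    using eventually_at_right_less by (rule eventually_mono) (rule bound)
  ultimately show "N q \<bullet> b + H a \<bullet> a / 2 \<le> - k"
    by (rule tendsto_upperbound[OF _ _ trivial_limit_at_right_real])
qed

text \<open>From a point \<open>x\<close> of \<open>S\<close> near \<open>q\<close> one moves along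
  \<open>n = N q\<close>. There \<open>r\<close> grows at rate at least
  \<open>(n \<bullet> n) / 2\<close>, so it ceases to be negative within the length
  \<open>2 * (- r x) / norm n\<close>, and the frontier is met by then. Hence
  \<open>m = norm n / 2\<close>.\<close>

lemma defining_function_le_infdist:
  fixes r :: "'a::euclidean_space \<Rightarrow> real"
  assumes S: "open S" "q \<in> frontier S"
    and U: "open U" "q \<in> U" "U \<inter> S = {x \<in> U. r x < 0}"
    and r: "\<And>x. x \<in> U \<Longrightarrow> (r has_derivative (\<lambda>v. N x \<bullet> v)) (at x)"
    and N: "isCont N q" "N q \<noteq> 0"
  obtains m where "m > 0" "\<forall>\<^sub>F x in nhds q. x \<in> S \<longrightarrow> r x \<le> - m * infdist x (frontier S)"
proof -
  define n where "n = N q"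
  have n: "n \<noteq> 0" using N(2) n_def by simp
  have rc: "continuous_on U r"
    by (auto intro!: continuous_at_imp_continuous_on has_derivative_continuous r)
  have rq: "r q = 0" by (rule defining_function_frontier[OF S(1) U(1,2) S(2) rc U(3)])
  have "((\<lambda>x. N x \<bullet> n) \<longlongrightarrow> n \<bullet> n) (nhds q)"
    using N(1) unfolding n_def by (intro tendsto_intros) (simp add: isCont_def tendsto_at_iff_tendsto_nhds)
  then have "\<forall>\<^sub>F x in nhds q. N x \<bullet> n > (n \<bullet> n) / 2"
    by (rule order_tendstoD) (use n in simp)
  then have "\<forall>\<^sub>F x in nhds q. N x \<bullet> n > (n \<bullet> n) / 2 \<and> x \<in> U"
    using U by (intro eventually_conj eventually_nhds_in_open)
  then obtain d where d: "d > 0" "\<And>x. dist x q < d \<Longrightarrow> N x \<bullet> n > (n \<bullet> n) / 2 \<and> x \<in> U"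
    by (auto simp: eventually_nhds_metric)
  have "isCont r q" using rc U by (simp add: continuous_on_eq_continuous_at)
  then have "(r \<longlongrightarrow> r q) (nhds q)" by (simp add: isCont_def tendsto_at_iff_tendsto_nhds)
  then have "(r \<longlongrightarrow> 0) (nhds q)" by (simp only: rq)
  \<comment> \<open>This bound makes the segment travelled from \<open>x\<close> shorter than
    \<open>d / 2\<close>, so that it stays where the gradient estimate holds.\<close>
  then have "\<forall>\<^sub>F x in nhds q. \<bar>r x\<bar> < d * norm n / 4"
    using tendstoD[of r 0 "nhds q" "d * norm n / 4"] d(1) n by simp
  moreover have "\<forall>\<^sub>F x in nhds q. dist x q < d / 2"
    using d(1) by (auto simp: eventually_nhds_metric intro!: exI[of _ "d / 2"])
  ultimately have "\<forall>\<^sub>F x in nhds q. x \<in> S \<longrightarrow> r x \<le> - (norm n / 2) * infdist x (frontier S)"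
  proof eventually_elim
    case (elim x)
    show ?case
    proof
      assume xS: "x \<in> S"
      have "dist x q < d" using elim(2) d(1) by simp
      then have "x \<in> U" using d(2) by blast
      then have rx: "r x < 0" using xS U(3) by blast
      define s where "s = 2 * (- r x) / (n \<bullet> n)"
      have s: "s > 0" unfolding s_def using rx n by (intro divide_pos_pos) auto
      have sn: "s * norm n = 2 * (- r x) / norm n"
        using n by (simp add: s_def dot_square_norm power2_eq_square)
      also have "\<dots> < d / 2" using elim(1) rx n by (simp add: field_simps)
      finally have snd: "s * norm n < d / 2" .
      have in_ball: "dist (x + u *\<^sub>R n) q < d" if "0 \<le> u" "u \<le> s" for u
      proof -
        have "dist (x + u *\<^sub>R n) q \<le> dist (x + u *\<^sub>R n) x + dist x q" by (rule dist_triangle)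
        also have "dist (x + u *\<^sub>R n) x = u * norm n" using that by (simp add: dist_norm)
        also have "u * norm n \<le> s * norm n" using that by (simp add: mult_right_mono)
        finally show ?thesis using snd elim(2) by simp
      qed
      have "((\<lambda>u. r (x + u *\<^sub>R n)) has_real_derivative N (x + u *\<^sub>R n) \<bullet> n) (at u)"
        if "0 \<le> u" "u \<le> s" for u
      proof -
        have "((\<lambda>u. x + u *\<^sub>R n) has_derivative (\<lambda>u. u *\<^sub>R n)) (at u)"
          by (auto intro!: derivative_eq_intros)
        moreover have "x + u *\<^sub>R n \<in> U" using d(2) in_ball that by blast
        ultimately show ?thesis
          using has_derivative_compose[OF _ r] by (force simp: has_field_derivative_def mult_commute_abs)
      qed
      then obtain u where u: "0 < u" "u < s"
        "r (x + s *\<^sub>R n) - r (x + 0 *\<^sub>R n) = (s - 0) * (N (x + u *\<^sub>R n) \<bullet> n)"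
        using MVT2[OF s, of "\<lambda>u. r (x + u *\<^sub>R n)" "\<lambda>u. N (x + u *\<^sub>R n) \<bullet> n"] by blast
      have "- r x = s * ((n \<bullet> n) / 2)" using n by (simp add: s_def)
      also have "\<dots> \<le> s * (N (x + u *\<^sub>R n) \<bullet> n)"
        using s d(2)[OF in_ball, of u] u by (intro mult_left_mono) auto
      finally have "\<not> r (x + s *\<^sub>R n) < 0" using u(3) by simp
      moreover have "x + s *\<^sub>R n \<in> U" using d(2)[OF in_ball, of s] s by simp
      ultimately have "x + s *\<^sub>R n \<notin> S" using U(3) by blast
      then have "closed_segment x (x + s *\<^sub>R n) - S \<noteq> {}" by auto
      moreover have "closed_segment x (x + s *\<^sub>R n) \<inter> S \<noteq> {}" using xS by auto
      ultimately have "closed_segment x (x + s *\<^sub>R n) \<inter> frontier S \<noteq> {}"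
        by (intro connected_Int_frontier connected_segment)
      then obtain y where y: "y \<in> closed_segment x (x + s *\<^sub>R n)" "y \<in> frontier S" by blast
      have "infdist x (frontier S) \<le> dist x y" using y(2) by (rule infdist_le)
      also have "\<dots> \<le> s * norm n"
        using segment_bound(1)[OF y(1)] s by (simp add: dist_norm norm_minus_commute)
      finally have "infdist x (frontier S) * (norm n / 2) \<le> s * norm n * (norm n / 2)"
        by (intro mult_right_mono) auto
      also have "\<dots> = - r x" using n by (simp add: sn)
      finally show "r x \<le> - (norm n / 2) * infdist x (frontier S)" by (simp add: mult.commute)
    qed
  qed
  then show thesis using that[of "norm n / 2"] n by simp
qed

text \<open>The exponent is \<open>of_real t * y t\<close> with \<open>y t\<close> tending to
  \<open>\<alpha>\<close>. The Taylor terms up to second order contribute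
  \<open>\<beta> + (y t)^2 / 2\<close>, and the cubic remainder divided by \<open>t^2\<close> is of
  order \<open>\<bar>t\<bar>\<close>.\<close>

lemma exp_quadratic_limit:
  fixes \<alpha> \<beta> :: complex
  shows "((\<lambda>t. (exp (\<alpha> * of_real t + \<beta> * (of_real t)\<^sup>2) - 1 - \<alpha> * of_real t) / (of_real t)\<^sup>2)
    \<longlongrightarrow> \<beta> + \<alpha>\<^sup>2 / 2) (at (0::real))"
proof -
  define x where "x t = \<alpha> * of_real t + \<beta> * (of_real t)\<^sup>2" for t :: real
  define y where "y t = \<alpha> + \<beta> * of_real t" for t :: real
  have xy: "x t = of_real t * y t" for t by (simp add: x_def y_def algebra_simps power2_eq_square)
  have lim: "(y \<longlongrightarrow> \<alpha>) (at 0)" "(x \<longlongrightarrow> 0) (at 0)"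
    unfolding x_def[abs_def] y_def[abs_def] by (auto intro!: tendsto_eq_intros)
  define R where "R t = (exp (x t) - (1 + x t + (x t)\<^sup>2 / 2)) / (of_real t)\<^sup>2" for t :: real
  have "((\<lambda>t. exp \<bar>Re (x t)\<bar> * norm (y t) ^ 3 * \<bar>t\<bar> / 2) \<longlongrightarrow> exp \<bar>Re 0\<bar> * norm \<alpha> ^ 3 * \<bar>0\<bar> / 2) (at 0)"
    by (intro tendsto_intros lim) simp
  then have "((\<lambda>t. exp \<bar>Re (x t)\<bar> * norm (y t) ^ 3 * \<bar>t\<bar> / 2) \<longlongrightarrow> 0) (at 0)" by simp
  moreover have "\<forall>\<^sub>F t in at 0. norm (R t) \<le> exp \<bar>Re (x t)\<bar> * norm (y t) ^ 3 * \<bar>t\<bar> / 2"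
  proof (rule always_eventually, rule allI)
    fix t
    show "norm (R t) \<le> exp \<bar>Re (x t)\<bar> * norm (y t) ^ 3 * \<bar>t\<bar> / 2"
    proof (cases "t = 0")
      case False
      have "(\<Sum>k\<le>2. x t ^ k / fact k) = 1 + x t + (x t)\<^sup>2 / 2"
        by (simp add: numeral_2_eq_2)
      then have "norm (exp (x t) - (1 + x t + (x t)\<^sup>2 / 2)) \<le> exp \<bar>Re (x t)\<bar> * norm (x t) ^ 3 / 2"
        using Taylor_exp[of "x t" 2] by (simp add: numeral_3_eq_3 fact_2)
      then have "norm (exp (x t) - (1 + x t + (x t)\<^sup>2 / 2)) / t\<^sup>2
          \<le> exp \<bar>Re (x t)\<bar> * norm (x t) ^ 3 / 2 / t\<^sup>2"
        by (rule divide_right_mono) simp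
      then have "norm (R t) \<le> exp \<bar>Re (x t)\<bar> * norm (x t) ^ 3 / 2 / t\<^sup>2"
        by (simp add: R_def norm_divide norm_power)
      also have "\<dots> = exp \<bar>Re (x t)\<bar> * norm (y t) ^ 3 * (\<bar>t\<bar> ^ 3 / t\<^sup>2) / 2"
        by (simp add: xy norm_mult power_mult_distrib ac_simps)
      also have "\<bar>t\<bar> ^ 3 / t\<^sup>2 = \<bar>t\<bar>"
        using False by (simp add: power2_eq_square power3_eq_cube flip: abs_mult)
      finally show ?thesis .
    qed (simp add: R_def)
  qed
  ultimately have "(R \<longlongrightarrow> 0) (at 0)" by (rule Lim_null_comparison[rotated])
  then have "((\<lambda>t. \<beta> + (y t)\<^sup>2 / 2 + R t) \<longlongrightarrow> \<beta> + \<alpha>\<^sup>2 / 2 + 0) (at 0)"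
    by (intro tendsto_intros lim) simp
  moreover have "\<forall>\<^sub>F t in at 0. \<beta> + (y t)\<^sup>2 / 2 + R t = (exp (x t) - 1 - \<alpha> * of_real t) / (of_real t)\<^sup>2"
    unfolding eventually_at_filter
  proof (intro always_eventually allI impI)
    fix t :: real assume "t \<noteq> 0"
    then have t: "(of_real t)\<^sup>2 \<noteq> (0::complex)" by simp
    have "(of_real t)\<^sup>2 * R t = exp (x t) - (1 + x t + (x t)\<^sup>2 / 2)" using t by (simp add: R_def)
    moreover have "x t = \<alpha> * of_real t + \<beta> * (of_real t)\<^sup>2" "(x t)\<^sup>2 = (of_real t)\<^sup>2 * (y t)\<^sup>2"
      by (simp_all add: x_def xy[unfolded x_def] power_mult_distrib)
    ultimately have "(of_real t)\<^sup>2 * (\<beta> + (y t)\<^sup>2 / 2 + R t) = exp (x t) - 1 - \<alpha> * of_real t"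
      by (simp add: algebra_simps)
    then show "\<beta> + (y t)\<^sup>2 / 2 + R t = (exp (x t) - 1 - \<alpha> * of_real t) / (of_real t)\<^sup>2"
      using t by (metis nonzero_mult_div_cancel_left)
  qed
  ultimately show ?thesis
    unfolding x_def by (simp add: tendsto_cong)
qed

subsection \<open>Discs touching the boundary\<close>

text \<open>On a complex line a real quadratic form splits into a harmonic part and a multiple of
  \<open>(norm \<tau>)^2\<close>, whose coefficient is the complex Hessian. The exponential of the
  harmonic part is the modulus of the holomorphic function
  \<open>exp (A * \<tau> + B * \<tau>^2)\<close>.\<close>

lemma quadratic_part_complex_line:
  fixes w n :: "complex ^ 'n"
  assumes H: "linear H"
  obtains A B :: complex where "\<And>\<tau>. n \<bullet> (\<tau> *s w) + H (\<tau> *s w) \<bullet> (\<tau> *s w) / 2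
    = Re (A * \<tau> + B * \<tau>\<^sup>2) + (H w \<bullet> w + H (\<i> *s w) \<bullet> (\<i> *s w)) / 4 * (norm \<tau>)\<^sup>2"
proof
  let ?v = "\<i> *s w"
  let ?A = "Complex (n \<bullet> w) (- (n \<bullet> ?v))"
  let ?B = "Complex ((H w \<bullet> w - H ?v \<bullet> ?v) / 4) (- (H w \<bullet> ?v + H ?v \<bullet> w) / 4)"
  fix \<tau> :: complex
  have \<tau>: "\<tau> *s w = Re \<tau> *\<^sub>R w + Im \<tau> *\<^sub>R ?v"
    by (simp add: vec_eq_iff complex_eq_iff)
  show "n \<bullet> (\<tau> *s w) + H (\<tau> *s w) \<bullet> (\<tau> *s w) / 2
    = Re (?A * \<tau> + ?B * \<tau>\<^sup>2) + (H w \<bullet> w + H ?v \<bullet> ?v) / 4 * (norm \<tau>)\<^sup>2"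
    unfolding \<tau> cmod_power2
    by (simp add: linear_add[OF H] linear_scale[OF H] inner_add_left inner_add_right
        power2_eq_square field_simps)
qed

text \<open>
  At second order the disc contributes \<open>\<sigma>\<^sup>2 b\<close> with \<open>b\<close> independent of \<open>\<sigma>\<close>, so this term cancels in the
  sum over \<open>\<sigma> = 1\<close> and \<open>\<sigma> = \<i>\<close>.
\<close>

lemma exp_disc:
  fixes w a :: "complex ^ 'n" and z :: "complex ^ 'n" and A B \<sigma> :: complex
  defines "\<gamma> \<equiv> \<lambda>t. z + (of_real t * \<sigma>) *s w
      + exp (A * (of_real t * \<sigma>) + B * (of_real t * \<sigma>)\<^sup>2) *s a"
  shows "(\<gamma> has_vector_derivative (\<sigma> *s (w + A *s a))) (at 0)"
    and "((\<lambda>t. (\<gamma> t - (z + a) - t *\<^sub>R (\<sigma> *s (w + A *s a))) /\<^sub>R t\<^sup>2)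
      \<longlongrightarrow> \<sigma>\<^sup>2 *s ((B + A\<^sup>2 / 2) *s a)) (at 0)"
proof -
  let ?\<alpha> = "A * \<sigma>" and ?\<beta> = "B * \<sigma>\<^sup>2"
  have \<gamma>: "\<gamma> = (\<lambda>t. z + (of_real t * \<sigma>) *s w + exp (?\<alpha> * of_real t + ?\<beta> * (of_real t)\<^sup>2) *s a)"
    by (simp add: \<gamma>_def algebra_simps)
  have "((\<lambda>t. complex_of_real t * \<sigma>) has_vector_derivative \<sigma>) (at 0)"
    by (rule has_vector_derivative_real_field) (auto intro!: derivative_eq_intros)
  moreover have "((\<lambda>t. exp (?\<alpha> * complex_of_real t + ?\<beta> * (of_real t)\<^sup>2)) has_vector_derivative ?\<alpha>) (at 0)"
    by (rule has_vector_derivative_real_field) (auto intro!: derivative_eq_intros)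
  ultimately have "(\<gamma> has_vector_derivative (0 + \<sigma> *s w + ?\<alpha> *s a)) (at 0)"
    unfolding \<gamma>
    by (intro has_vector_derivative_add has_vector_derivative_const
        bounded_linear.has_vector_derivative[OF bounded_linear_vector_scalar_mult])
  then show "(\<gamma> has_vector_derivative (\<sigma> *s (w + A *s a))) (at 0)"
    by (simp add: vector_add_ldistrib vector_smult_assoc mult.commute)
  define E where "E t = exp (?\<alpha> * of_real t + ?\<beta> * (of_real t)\<^sup>2)" for t :: real
  have "(\<gamma> t - (z + a) - t *\<^sub>R (\<sigma> *s (w + A *s a))) /\<^sub>R t\<^sup>2
      = ((E t - 1 - ?\<alpha> * of_real t) / (of_real t)\<^sup>2) *s a" for t
  proof -
    have "\<gamma> t - (z + a) - t *\<^sub>R (\<sigma> *s (w + A *s a)) = (E t - 1 - ?\<alpha> * of_real t) *s a"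
      unfolding \<gamma> E_def[symmetric]
      by (simp add: vec_eq_iff) (simp add: scaleR_conv_of_real algebra_simps)
    then show ?thesis
      by (simp only:) (simp add: vec_eq_iff scaleR_conv_of_real[where 'a = complex] divide_inverse algebra_simps)
  qed
  then have eq: "(\<lambda>t. (\<gamma> t - (z + a) - t *\<^sub>R (\<sigma> *s (w + A *s a))) /\<^sub>R t\<^sup>2)
      = (\<lambda>t. ((E t - 1 - ?\<alpha> * of_real t) / (of_real t)\<^sup>2) *s a)" by blast
  have \<sigma>: "\<sigma>\<^sup>2 *s ((B + A\<^sup>2 / 2) *s a) = (?\<beta> + ?\<alpha>\<^sup>2 / 2) *s a"
    by (simp add: vector_smult_assoc power_mult_distrib algebra_simps)
  show "((\<lambda>t. (\<gamma> t - (z + a) - t *\<^sub>R (\<sigma> *s (w + A *s a))) /\<^sub>R t\<^sup>2)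
      \<longlongrightarrow> \<sigma>\<^sup>2 *s ((B + A\<^sup>2 / 2) *s a)) (at 0)"
    unfolding eq \<sigma> E_def
    by (rule bounded_linear.tendsto[OF bounded_linear_vector_scalar_mult exp_quadratic_limit])
qed

text \<open>By \<open>Re_complex_hessian\<close>, conclusion and hypothesis \<open>levi\<close>
  concern four times the complex Hessians of \<open>- ln d\<close> and \<open>r\<close>; the two
  orthogonality conditions say that \<open>V\<close> is complex tangential. The touching disc is
  built at one point \<open>z\<close> with one nearest point \<open>q\<close>.\<close>

lemma levi_imp_hessian_neg_ln_infdist:
  fixes S :: "(complex ^ 'n) set"
  assumes S: "open S" and q: "q \<in> frontier S" "dist z q = infdist z (frontier S)"
    and W: "open W" "z \<in> W" "W \<subseteq> S"
    and f: "\<And>x. x \<in> W \<Longrightarrow> ((\<lambda>x. - ln (infdist x (frontier S))) has_derivative (\<lambda>v. N x \<bullet> v)) (at x)"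
    and N: "(N has_derivative H) (at z)"
    and U: "open U" "q \<in> U" "U \<inter> S = {x \<in> U. r x < 0}"
    and r: "\<And>x. x \<in> U \<Longrightarrow> (r has_derivative (\<lambda>v. R x \<bullet> v)) (at x)"
    and R: "(R has_derivative K) (at q)" "R q \<noteq> 0"
    and levi: "\<And>V. R q \<bullet> V = 0 \<Longrightarrow> R q \<bullet> (\<i> *s V) = 0 \<Longrightarrow> 0 \<le> K V \<bullet> V + K (\<i> *s V) \<bullet> (\<i> *s V)"
  shows "0 \<le> H w \<bullet> w + H (\<i> *s w) \<bullet> (\<i> *s w)"
proof (rule ccontr)
  assume neg: "\<not> 0 \<le> H w \<bullet> w + H (\<i> *s w) \<bullet> (\<i> *s w)"
  \<comment> \<open>The supposed negative value of the complex Hessian is \<open>- c\<close>, so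
    \<open>c\<close> is the coefficient of \<open>(norm \<tau>)^2\<close> in the expansion of
    \<open>ln d\<close>.\<close>
  define c where "c = - (H w \<bullet> w + H (\<i> *s w) \<bullet> (\<i> *s w)) / 4"
  have c: "c > 0" using neg by (simp add: c_def)
  let ?F = "frontier S"
  define d where "d x = infdist x ?F" for x
  have dpos: "d x > 0" if "x \<in> S" for x
    unfolding d_def using that S q(1)
    by (intro infdist_pos_not_in_closed frontier_closed) (auto simp: frontier_def interior_open)
  have dz: "dist z q = d z" "d z > 0" using q dpos W by (auto simp: d_def)
  have linH: "linear H" using N by (rule has_derivative_linear)
  then have linH': "linear (\<lambda>v. - H v)" by (rule linear_compose_neg)
  obtain A B where AB: "\<And>\<tau>. - N z \<bullet> (\<tau> *s w) + - H (\<tau> *s w) \<bullet> (\<tau> *s w) / 2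
      = Re (A * \<tau> + B * \<tau>\<^sup>2) + (- H w \<bullet> w + - H (\<i> *s w) \<bullet> (\<i> *s w)) / 4 * (norm \<tau>)\<^sup>2"
    using quadratic_part_complex_line[OF linH', of "- N z" w] by blast
  \<comment> \<open>The Taylor error may use up at most half of \<open>c\<close>; the
    \<open>+ 1\<close> keeps the denominator positive for every \<open>w\<close>.\<close>
  define e where "e = c / (2 * ((norm w)\<^sup>2 + 1))"
  have e: "e > 0" using c by (auto simp: e_def intro!: divide_pos_pos add_nonneg_pos)
  have ew: "e * (norm w)\<^sup>2 \<le> c / 2"
  proof -
    have "(norm w)\<^sup>2 + 1 > 0" by (simp add: add_nonneg_pos)
    then show ?thesis using c by (simp add: e_def divide_simps) 
  qed
  obtain \<delta> where \<delta>: "\<delta> > 0" "\<And>h. norm h < \<delta> \<Longrightarrow>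
      \<bar>- ln (d (z + h)) - - ln (d z) - N z \<bullet> h - H h \<bullet> h / 2\<bar> \<le> e * (norm h)\<^sup>2"
    using second_order_Taylor[OF W(1,2) f N e] unfolding d_def by blast
  obtain m where m: "m > 0" "\<forall>\<^sub>F x in nhds q. x \<in> S \<longrightarrow> r x \<le> - m * d x"
    unfolding d_def
    using defining_function_le_infdist[OF S q(1) U r has_derivative_continuous[OF R(1)] R(2)] by blast
  have rc: "continuous_on U r"
    by (auto intro!: continuous_at_imp_continuous_on has_derivative_continuous r)
  have rq: "r q = 0" by (rule defining_function_frontier[OF S U(1,2) q(1) rc U(3)])
  define a where "a = q - z"
  have na: "norm a = d z" using dz(1) by (simp add: a_def dist_norm norm_minus_commute)
  define X where "X \<tau> = A * \<tau> + B * \<tau>\<^sup>2" for \<tau>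
  define \<gamma> where "\<gamma> \<sigma> t = z + (of_real t * \<sigma>) *s w + exp (X (of_real t * \<sigma>)) *s a" for \<sigma> t
  \<comment> \<open>The margin \<open>d z * c / 4\<close> comes from
    \<open>exp (c / 2 * t^2) \<ge> 1 + c / 2 * t^2\<close> and \<open>E > 1 / 2\<close>; the factor
    \<open>m\<close> passes from the distance to \<open>r\<close>.\<close>
  define k where "k = m * (d z * c / 4)"
  have k: "k > 0" using m c dz by (simp add: k_def)
  have max: "\<forall>\<^sub>F t in at 0. r (\<gamma> \<sigma> t) \<le> r q - k * t\<^sup>2" if \<sigma>: "norm \<sigma> = 1" for \<sigma>
  proof -
    have lim_w: "((\<lambda>t. (of_real t * \<sigma>) *s w) \<longlongrightarrow> 0) (at 0)"
      by (rule bounded_linear.tendsto_zero[OF bounded_linear_vector_scalar_mult])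
        (auto intro!: tendsto_eq_intros)
    have lim_X: "((\<lambda>t. X (of_real t * \<sigma>)) \<longlongrightarrow> 0) (at 0)"
      unfolding X_def by (auto intro!: tendsto_eq_intros)
    have "((\<lambda>t. \<gamma> \<sigma> t) \<longlongrightarrow> z + 0 + exp 0 *s a) (at 0)"
      unfolding \<gamma>_def
      by (intro tendsto_add tendsto_const lim_w
          bounded_linear.tendsto[OF bounded_linear_vector_scalar_mult] tendsto_exp lim_X)
    then have lim_\<gamma>: "((\<lambda>t. \<gamma> \<sigma> t) \<longlongrightarrow> q) (at 0)" by (simp add: a_def)
    have "\<forall>\<^sub>F t in at 0. norm ((of_real t * \<sigma>) *s w) < \<delta>"
      using tendstoD[OF lim_w \<delta>(1)] by simp
    moreover have "\<forall>\<^sub>F t in at 0. z + (of_real t * \<sigma>) *s w \<in> W"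
      by (rule topological_tendstoD[OF _ W(1)]) (use tendsto_add[OF tendsto_const lim_w, of z] W(2) in auto)
    moreover have "\<forall>\<^sub>F t in at 0. exp (Re (X (of_real t * \<sigma>))) > 1 / 2"
      by (rule order_tendstoD[OF tendsto_exp[OF tendsto_Re[OF lim_X]]]) simp
    moreover have "\<forall>\<^sub>F t in at 0. \<gamma> \<sigma> t \<in> S \<longrightarrow> r (\<gamma> \<sigma> t) \<le> - m * d (\<gamma> \<sigma> t)"
      by (rule eventually_compose_filterlim[OF m(2) lim_\<gamma>])
    moreover have "\<forall>\<^sub>F t in at (0::real). t \<noteq> 0" by (simp add: eventually_at_filter)
    ultimately show ?thesis
    proof eventually_elim
      case (elim t)
      define \<tau> where "\<tau> = of_real t * \<sigma>"
      define h where "h = \<tau> *s w"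
      define E where "E = exp (Re (X \<tau>))"
      have nt: "(norm \<tau>)\<^sup>2 = t\<^sup>2" using \<sigma> by (simp add: \<tau>_def norm_mult)
      have E: "E > 1 / 2" using elim(3) by (simp add: E_def \<tau>_def)
      have zhW: "z + h \<in> W" using elim(2) by (simp add: h_def \<tau>_def)
      then have zh: "z + h \<in> S" using W(3) by blast
      have "e * (norm h)\<^sup>2 = (e * (norm w)\<^sup>2) * t\<^sup>2"
        by (simp add: h_def norm_vector_scalar_mult power_mult_distrib nt)
      also have "\<dots> \<le> c / 2 * t\<^sup>2" using ew by (rule mult_right_mono) simp
      finally have eh: "e * (norm h)\<^sup>2 \<le> c / 2 * t\<^sup>2" .
      have "- (N z \<bullet> h) - H h \<bullet> h / 2 = Re (X \<tau>) + c * t\<^sup>2"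
        using AB[of \<tau>] by (simp add: X_def c_def nt h_def)
      moreover have "\<bar>- ln (d (z + h)) - - ln (d z) - N z \<bullet> h - H h \<bullet> h / 2\<bar> \<le> e * (norm h)\<^sup>2"
        using elim(1) by (intro \<delta>(2)) (simp add: h_def \<tau>_def)
      ultimately have "ln (d z) + Re (X \<tau>) + c / 2 * t\<^sup>2 \<le> ln (d (z + h))"
        using eh by (simp add: abs_le_iff)
      then have "exp (ln (d z) + Re (X \<tau>) + c / 2 * t\<^sup>2) \<le> exp (ln (d (z + h)))" by simp
      then have "d z * E * exp (c / 2 * t\<^sup>2) \<le> d (z + h)"
        using dz dpos[OF zh] by (simp add: exp_add E_def)
      moreover have "d z * E * (1 + c / 2 * t\<^sup>2) \<le> d z * E * exp (c / 2 * t\<^sup>2)"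
        using dz E by (intro mult_left_mono exp_ge_add_one_self) auto
      ultimately have 1: "d z * E + d z * E * (c / 2 * t\<^sup>2) \<le> d (z + h)"
        by (simp add: distrib_left)
      have "(d z * c / 2 * t\<^sup>2) * (1 / 2) \<le> (d z * c / 2 * t\<^sup>2) * E"
        using dz c E by (intro mult_left_mono) auto
      then have 2: "d z * c / 4 * t\<^sup>2 \<le> d z * E * (c / 2 * t\<^sup>2)" by (simp add: mult_ac)
      have "dist (z + h) (\<gamma> \<sigma> t) = norm (exp (X \<tau>) *s a)"
        by (simp add: \<gamma>_def dist_norm h_def \<tau>_def)
      also have "\<dots> = d z * E"
        by (simp add: norm_vector_scalar_mult E_def na)
      finally have 3: "dist (z + h) (\<gamma> \<sigma> t) = d z * E" .
      have pos: "d z * c / 4 * t\<^sup>2 > 0" using dz c elim(5) by simp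
      \<comment> \<open>The point of the disc is strictly closer to \<open>z + h\<close> than the
        frontier is, so it lies in \<open>S\<close>. The amount of the gap then bounds its own
        distance to the frontier from below.\<close>
      have "dist (z + h) (\<gamma> \<sigma> t) < d (z + h)" using 1 2 3 pos by linarith
      then have "\<gamma> \<sigma> t \<in> ball (z + h) (infdist (z + h) ?F)" by (simp add: d_def)
      then have "\<gamma> \<sigma> t \<in> S" using ball_infdist_frontier_subset[OF zh] by blast
      then have "r (\<gamma> \<sigma> t) \<le> - m * d (\<gamma> \<sigma> t)" using elim(4) by blast
      moreover have "d (z + h) \<le> d (\<gamma> \<sigma> t) + dist (z + h) (\<gamma> \<sigma> t)"
        unfolding d_def by (rule infdist_triangle)
      then have "d z * c / 4 * t\<^sup>2 \<le> d (\<gamma> \<sigma> t)" using 1 2 3 by linarith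
      then have "m * (d z * c / 4 * t\<^sup>2) \<le> m * d (\<gamma> \<sigma> t)" using m(1) by simp
      ultimately show ?case by (simp add: rq k_def mult_ac)
    qed
  qed
  define V where "V = w + A *s a"
  define b where "b = (B + A\<^sup>2 / 2) *s a"
  have \<gamma>0: "\<gamma> \<sigma> 0 = q" for \<sigma> by (simp add: \<gamma>_def X_def a_def)
  have tangent: "R q \<bullet> (\<sigma> *s V) = 0"
    and second: "R q \<bullet> (\<sigma>\<^sup>2 *s b) + K (\<sigma> *s V) \<bullet> (\<sigma> *s V) / 2 \<le> - k" if \<sigma>: "norm \<sigma> = 1" for \<sigma>
  proof -
    have D: "(\<gamma> \<sigma> has_vector_derivative \<sigma> *s V) (at 0)"
      using exp_disc(1)[of z \<sigma> w A B a] unfolding \<gamma>_def X_def V_def .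
    have L: "((\<lambda>t. (\<gamma> \<sigma> t - q - t *\<^sub>R (\<sigma> *s V)) /\<^sub>R t\<^sup>2) \<longlongrightarrow> \<sigma>\<^sup>2 *s b) (at 0)"
      using exp_disc(2)[of z \<sigma> w A B a] unfolding \<gamma>_def X_def V_def b_def by (simp add: a_def)
    show "R q \<bullet> (\<sigma> *s V) = 0"
      by (rule second_derivative_test_curve(1)[OF U(1,2) r R(1) \<gamma>0 D L max[OF \<sigma>] less_imp_le[OF k]])
    show "R q \<bullet> (\<sigma>\<^sup>2 *s b) + K (\<sigma> *s V) \<bullet> (\<sigma> *s V) / 2 \<le> - k"
      by (rule second_derivative_test_curve(2)[OF U(1,2) r R(1) \<gamma>0 D L max[OF \<sigma>] less_imp_le[OF k]])
  qed
  \<comment> \<open>The \<open>b\<close> terms enter with factors \<open>1\<close> and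
    \<open>\<i>^2 = - 1\<close>, so adding both inequalities cancels them and leaves \<open>K V
    \<bullet> V + K (\<i> *s V) \<bullet> (\<i> *s V) \<le> - 4 * k\<close>.\<close>
  have "R q \<bullet> b + K V \<bullet> V / 2 \<le> - k" using second[of 1] by simp
  moreover have "- (R q \<bullet> b) + K (\<i> *s V) \<bullet> (\<i> *s V) / 2 \<le> - k" using second[of \<i>] by simp
  moreover have "0 \<le> K V \<bullet> V + K (\<i> *s V) \<bullet> (\<i> *s V)"
    using tangent[of 1] tangent[of \<i>] by (intro levi) simp_all
  ultimately show False using k by simp
qed

section \<open>Plurisubharmonicity near the boundary\<close>

text \<open>The sum of \<open>cnj (n $ k) * V $ k\<close> is twice the holomorphic differential of
  \<open>r\<close> on \<open>V\<close>; its real and imaginary parts are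
  \<open>n \<bullet> V\<close> and \<open>- (n \<bullet> (\<i> *s V))\<close>.\<close>

lemma complex_tangent_spaceI:
  fixes r :: "complex ^ 'n \<Rightarrow> real"
  assumes "(r has_derivative (\<lambda>v. n \<bullet> v)) (at q)" "n \<bullet> V = 0" "n \<bullet> (\<i> *s V) = 0"
  shows "V \<in> complex_tangent_space r q"
proof -
  have "Re (\<Sum>k\<in>UNIV. cnj (n $ k) * V $ k) = n \<bullet> V"
    "Im (\<Sum>k\<in>UNIV. cnj (n $ k) * V $ k) = - (n \<bullet> (\<i> *s V))"
    by (simp_all add: inner_vec_def inner_complex_def flip: sum_negf)
  then have "(\<Sum>k\<in>UNIV. cnj (n $ k) * V $ k) = 0"
    using assms(2,3) by (simp add: complex_eq_iff)
  then show ?thesis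
    by (simp add: complex_tangent_space_def deriv_z_of_real(1)[OF assms(1)] flip: sum_divide_distrib)
qed

theorem theorem4p1:
  fixes \<Omega> :: "(complex ^ 'n::finite) set"
  assumes "smoothly_bounded_domain \<Omega>"
    and "pseudoconvex \<Omega>"
  shows "\<exists>U. open U \<and> frontier \<Omega> \<subseteq> U \<and>
           plurisubharmonic_on (U \<inter> \<Omega>) (\<lambda>z. - ln (- signed_distance \<Omega> z))"
proof -
  let ?f = "\<lambda>z. - ln (- signed_distance \<Omega> z)" and ?F = "frontier \<Omega>"
  have \<Omega>: "open \<Omega>" using assms(1) by (simp add: smoothly_bounded_domain_def)
  have f_eq: "?f x = - ln (infdist x ?F)" if "x \<in> \<Omega>" for x
    using that by (simp add: signed_distance_def)
  have psh: "\<exists>W. open W \<and> p \<in> W \<and> plurisubharmonic_on (W \<inter> \<Omega>) ?f" if p: "p \<in> ?F" for p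
  proof -
    obtain U r where "local_defining_function \<Omega> p U r"
      using assms(1) p unfolding smoothly_bounded_domain_def by blast
    then have U: "open U" "p \<in> U" "smooth_on U r" "U \<inter> \<Omega> = {z \<in> U. r z < 0}"
      "\<And>z. z \<in> U \<Longrightarrow> gradient r z \<noteq> 0"
      by (auto simp: local_defining_function_def)
    obtain G where G: "\<And>x. x \<in> U \<Longrightarrow> (r has_derivative (\<lambda>v. gradient r x \<bullet> v)) (at x)"
      "\<And>x. x \<in> U \<Longrightarrow> (gradient r has_derivative G x) (at x)" "\<And>v. continuous_on U (\<lambda>x. G x v)"
      using smooth_on_gradient[OF U(3,1)] by blast
    obtain W y y' where W: "open W" "p \<in> W" "\<And>z. z \<in> W \<Longrightarrow> (y has_derivative y' z) (at z)"
      "\<And>v. continuous_on W (\<lambda>z. y' z v)"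
      "\<And>z. z \<in> W \<inter> \<Omega> \<Longrightarrow> y z \<in> ?F \<and> dist z (y z) = infdist z ?F"
      using nearest_point_C1[OF \<Omega> p U(1,2,4) G(1,2) U(5) G(3)] by metis
    let ?S = "W \<inter> \<Omega>"
    have S: "open ?S" using W(1) \<Omega> by blast
    have pos: "infdist z ?F > 0" if "z \<in> ?S" for z
      using that p \<Omega>
      by (intro infdist_pos_not_in_closed frontier_closed) (auto simp: frontier_def interior_open)
    obtain N H where
      NH: "\<And>z. z \<in> ?S \<Longrightarrow> ((\<lambda>x. - ln (infdist x ?F)) has_derivative (\<lambda>v. N z \<bullet> v)) (at z)"
      "\<And>z. z \<in> ?S \<Longrightarrow> (N has_derivative H z) (at z)" "\<And>v. continuous_on ?S (\<lambda>z. H z v)"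
      using neg_ln_infdist_derivatives[of ?S y y' ?F, OF S W(3) continuous_on_subset[OF W(4)] W(5) pos]
      by (metis Int_iff Int_lower1)
    have f: "(?f has_derivative (\<lambda>v. N z \<bullet> v)) (at z)" if "z \<in> ?S" for z
      by (rule has_derivative_transform_within_open[OF NH(1)[OF that] S that])
        (use f_eq in auto)
    have "0 \<le> Re (complex_hessian ?f z w w)" if z: "z \<in> ?S" for z w
    proof -
      define q where "q = y z"
      have q: "q \<in> ?F" "dist z q = infdist z ?F" using W(5)[OF z] by (auto simp: q_def)
      \<comment> \<open>The Levi condition is needed at the nearest point \<open>q\<close>, not at
        \<open>p\<close>, so a second defining function is taken from pseudoconvexity at
        \<open>q\<close>.\<close>
      obtain U r where U0: "local_defining_function \<Omega> q U r"
        and levi0: "\<forall>q\<in>U \<inter> ?F. \<forall>V\<in>complex_tangent_space r q. 0 \<le> Re (complex_hessian r q V V)"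
        using assms(2) q(1) unfolding pseudoconvex_def by blast
      from U0 have U: "open U" "q \<in> U" "smooth_on U r" "U \<inter> \<Omega> = {z \<in> U. r z < 0}"
        "gradient r q \<noteq> 0"
        by (auto simp: local_defining_function_def)
      have levi: "0 \<le> Re (complex_hessian r q V V)" if "V \<in> complex_tangent_space r q" for V
        using levi0 U(2) q(1) that by blast
      obtain K where K: "\<And>x. x \<in> U \<Longrightarrow> (r has_derivative (\<lambda>v. gradient r x \<bullet> v)) (at x)"
        "\<And>x. x \<in> U \<Longrightarrow> (gradient r has_derivative K x) (at x)" "\<And>v. continuous_on U (\<lambda>x. K x v)"
        using smooth_on_gradient[OF U(3,1)] by blast
      have "0 \<le> H z w \<bullet> w + H z (\<i> *s w) \<bullet> (\<i> *s w)"
      proof (rule levi_imp_hessian_neg_ln_infdist[OF \<Omega> q S z Int_lower2 NH(1) NH(2)[OF z]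
            U(1,2,4) K(1) K(2)[OF U(2)] U(5)])
        fix V assume "gradient r q \<bullet> V = 0" "gradient r q \<bullet> (\<i> *s V) = 0"
        then have "V \<in> complex_tangent_space r q"
          by (rule complex_tangent_spaceI[OF K(1)[OF U(2)]])
        then have "0 \<le> Re (complex_hessian r q V V)" by (rule levi)
        then show "0 \<le> K q V \<bullet> V + K q (\<i> *s V) \<bullet> (\<i> *s V)"
          using Re_complex_hessian[OF U(1,2) K(1) K(2)[OF U(2)], of V] by simp
      qed
      then show ?thesis
        using Re_complex_hessian[OF S z f NH(2)[OF z], of w] by simp
    qed
    then have "plurisubharmonic_on ?S ?f"
      using S Ck_on_2I[OF S f NH(2,3)] by (simp add: plurisubharmonic_on_def)
    then show ?thesis using W(1,2) by blast
  qed
  \<comment> \<open>Taking all admissible open sets at once avoids choosing one per boundary point;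
    regularity and positivity are local and pass to the union.\<close>
  define U where "U = \<Union>{W. open W \<and> plurisubharmonic_on (W \<inter> \<Omega>) ?f}"
  have "plurisubharmonic_on (U \<inter> \<Omega>) ?f"
    unfolding plurisubharmonic_on_def
  proof (intro conjI ballI allI)
    show "open (U \<inter> \<Omega>)" using \<Omega> by (auto simp: U_def)
    have loc: "\<exists>T. x \<in> T \<and> plurisubharmonic_on T ?f" if "x \<in> U \<inter> \<Omega>" for x
      using that by (auto simp: U_def)
    show "Ck_on 2 (U \<inter> \<Omega>) ?f"
      by (rule Ck_on_local) (use loc plurisubharmonic_on_def in metis)
    show "0 \<le> Re (complex_hessian ?f z w w)" if "z \<in> U \<inter> \<Omega>" for z w
      using loc[OF that] by (auto simp: plurisubharmonic_on_def)
  qed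
  moreover have "open U" by (auto simp: U_def)
  moreover have "?F \<subseteq> U" using psh by (auto simp: U_def)
  ultimately show ?thesis by blast
qed

end
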